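(* Let $G=\{N\in U(2m,\mathbb{F}_{q^2}) : N^TJ_{2m}\bar N=J_{2m}\}$ be the Sylow $p$-subgroup of $GU(2m,q^2)$ consisting of its lower unitriangular matrices. For $k\ge 1$ let $h_k=\sum_{i=1}^m\left(x_{2m-i+1}^{q^{2k-1}}x_i+x_{2m-i+1}x_i^{q^{2k-1}}\right)$. Then the invariant field $\mathbb{F}_{q^2}(V)^G$ is generated by the polynomials $N(x_j)$, $j=1,\dots,m+1$, and $h_k$, $k=1,\dots,m-1$; i.e. $$\mathbb{F}_{q^2}(V)^G=\mathbb{F}_{q^2}(x_1,N(x_2),\dots,N(x_{m+1}),h_1,\dots,h_{m-1}).$$
   Context: $q$ is a power of a prime $p$, $m\ge 1$, $V=\mathbb{F}_{q^2}^{2m}$ (column vectors) with $x_1,\dots,x_{2m}$ the dual basis of the standard basis; $\mathbb{F}_{q^2}[V]=\mathbb{F}_{q^2}[x_1,\dots,x_{2m}]$, $\mathbb{F}_{q^2}(V)$ is its fraction field, and $G$ acts by $(g\cdot f)(v)=f(g^{-1}v)$. $N(x_j)=\prod_{y\in G\cdot x_j}y$ is the product over the $G$-orbit of $x_j$ (so $N(x_1)=x_1$). $U(n,\mathbb{F})$ is the group of lower triangular $n\times n$ matrices over $\mathbb{F}$ with ones on the diagonal; $\bar N=[n_{ij}^q]$; $J_n$ is the $n\times n$ matrix with ones on the antidiagonal and zeros elsewhere; $GU(2m,q^2)=\{M\in GL_{2m}(\mathbb{F}_{q^2}):M^TJ_{2m}\bar M=J_{2m}\}$. *)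

theory Defs
  imports
    "HOL-Library.Poly_Mapping"
    "HOL-Library.Cardinality"
    "HOL-Computational_Algebra.Fraction_Field"
    "HOL-Algebra.Group_Action"
    "HOL-Algebra.Generated_Fields"
    "HOL-Algebra.Algebraic_Closure_Type"
    "HOL-Number_Theory.Residues"
    "Jordan_Normal_Form.Determinant"
begin

section \<open>Polynomials and rational functions in \<open>x\<^sub>1, \<dots>, x\<^sub>n\<close>\<close>

type_synonym 'a mpoly = "(nat \<Rightarrow>\<^sub>0 nat) \<Rightarrow>\<^sub>0 'a"

definition Const :: "'a::zero \<Rightarrow> 'a mpoly" where
  "Const c = Poly_Mapping.single 0 c"

definition Var :: "nat \<Rightarrow> 'a::zero_neq_one mpoly" where
  "Var i = Poly_Mapping.single (Poly_Mapping.single i 1) 1"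

text \<open>The type \<open>'a mpoly\<close> has a variable for every natural number; the polynomial ring
  in \<open>x\<^sub>1, \<dots>, x\<^sub>n\<close> is carved out as a set.\<close>

definition polys_in :: "nat \<Rightarrow> 'a::zero mpoly set" where
  "polys_in n = {f. \<forall>k \<in> Poly_Mapping.keys f. Poly_Mapping.keys k \<subseteq> {1..n}}"

definition poly_fract :: "'a::idom mpoly \<Rightarrow> 'a mpoly fract" where
  "poly_fract f = Fract f 1"

definition function_field :: "nat \<Rightarrow> 'a::field mpoly fract ring" where
  "function_field n = ring_of_type_algebra
     \<lparr>carrier := {Fract a b | a b. a \<in> polys_in n \<and> b \<in> polys_in n \<and> b \<noteq> 0}\<rparr>"

definition adjoin_fractions :: "nat \<Rightarrow> 'a::field mpoly fract set \<Rightarrow> 'a mpoly fract set" where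
  "adjoin_fractions n S =
     generate_field (function_field n) (range (\<lambda>c. poly_fract (Const c)) \<union> S)"

definition subst_poly :: "(nat \<Rightarrow> 'a mpoly) \<Rightarrow> 'a::comm_ring_1 mpoly \<Rightarrow> 'a mpoly" where
  "subst_poly \<sigma> f = (\<Sum>k \<in> Poly_Mapping.keys f.
     Const (Poly_Mapping.lookup f k) * (\<Prod>i \<in> Poly_Mapping.keys k. \<sigma> i ^ Poly_Mapping.lookup k i))"


section \<open>Matrix groups\<close>

definition GL :: "nat \<Rightarrow> 'a::field mat monoid" where
  "GL n = units_of (ring_mat TYPE('a) n ())"

definition lower_unitriangular :: "nat \<Rightarrow> 'a::field mat set" where
  "lower_unitriangular n = {A \<in> carrier_mat n n.
     (\<forall>i<n. A $$ (i,i) = 1) \<and> (\<forall>i<n. \<forall>j<n. i < j \<longrightarrow> A $$ (i,j) = 0)}"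

definition antidiag :: "nat \<Rightarrow> 'a::field mat" where
  "antidiag n = mat n n (\<lambda>(i,j). if i + j + 1 = n then 1 else 0)"

definition bar :: "nat \<Rightarrow> 'a::field mat \<Rightarrow> 'a mat" where
  "bar q A = map_mat (\<lambda>a. a ^ q) A"

definition GU :: "nat \<Rightarrow> nat \<Rightarrow> 'a::field mat monoid" where
  "GU q n = GL n \<lparr>carrier :=
     {M \<in> carrier (GL n). transpose_mat M * antidiag n * bar q M = antidiag n}\<rparr>"

definition sylow_GU :: "nat \<Rightarrow> nat \<Rightarrow> 'a::field mat monoid" where
  "sylow_GU q n = GL n \<lparr>carrier :=
     {N \<in> lower_unitriangular n. transpose_mat N * antidiag n * bar q N = antidiag n}\<rparr>"


section \<open>The action on polynomials and rational functions\<close>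

text \<open>Over a finite field a polynomial is not determined by its values, so
  \<open>(g \<cdot> f)(v) = f(g\<^sup>-\<^sup>1 v)\<close> is read as the algebra automorphism determined by its effect on the
  coordinate functions: \<open>x\<^sub>i\<close> goes to \<open>\<Sum>\<^sub>j (g\<^sup>-\<^sup>1)\<^sub>i\<^sub>j x\<^sub>j\<close>. Matrix entries are indexed from 0,
  variables from 1. Variables outside \<open>x\<^sub>1, \<dots>, x\<^sub>n\<close> play no role and are left fixed.\<close>

definition lin_subst :: "nat \<Rightarrow> 'a::field mat \<Rightarrow> nat \<Rightarrow> 'a mpoly" where
  "lin_subst n A i =
     (if i \<in> {1..n} then \<Sum>j=1..n. Const (A $$ (i - 1, j - 1)) * Var j else Var i)"

definition act_poly :: "nat \<Rightarrow> 'a::field mat \<Rightarrow> 'a mpoly \<Rightarrow> 'a mpoly" where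
  "act_poly n g f = subst_poly (lin_subst n (inv\<^bsub>GL n\<^esub> g)) f"

text \<open>Well-defined for \<open>g\<close> in \<open>GL n\<close>: see \<open>act_fract_Fract\<close> below.\<close>

definition act_fract :: "nat \<Rightarrow> 'a::field mat \<Rightarrow> 'a mpoly fract \<Rightarrow> 'a mpoly fract" where
  "act_fract n g r =
     (THE s. \<exists>a b. b \<noteq> 0 \<and> r = Fract a b \<and> s = Fract (act_poly n g a) (act_poly n g b))"

definition invariant_field :: "'a::field mat monoid \<Rightarrow> nat \<Rightarrow> 'a mpoly fract set" where
  "invariant_field G n = {r \<in> carrier (function_field n). \<forall>g \<in> carrier G. act_fract n g r = r}"

definition orbit_product :: "'a::field mat monoid \<Rightarrow> nat \<Rightarrow> 'a mpoly \<Rightarrow> 'a mpoly" where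
  "orbit_product G n f = (\<Prod>y \<in> orbit G (act_poly n) f. y)"

definition h_poly :: "nat \<Rightarrow> nat \<Rightarrow> nat \<Rightarrow> 'a::field mpoly" where
  "h_poly q m k = (\<Sum>i=1..m. Var (2*m - i + 1) ^ (q ^ (2*k - 1)) * Var i
                      + Var (2*m - i + 1) * Var i ^ (q ^ (2*k - 1)))"

section \<open>Well-definedness\<close>

lemma sum_monomials:
  "(\<Sum>k \<in> Poly_Mapping.keys f. Poly_Mapping.single k (Poly_Mapping.lookup f k)) = f"
  by (rule poly_mapping_eqI)
    (auto simp: lookup_sum lookup_single when_def in_keys_iff sum.delta)

lemma subst_poly_superset:
  assumes "finite A" "Poly_Mapping.keys f \<subseteq> A"
  shows "subst_poly \<sigma> f = (\<Sum>k \<in> A.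
     Const (Poly_Mapping.lookup f k) * (\<Prod>i \<in> Poly_Mapping.keys k. \<sigma> i ^ Poly_Mapping.lookup k i))"
  unfolding subst_poly_def
  by (rule sum.mono_neutral_left) (use assms in \<open>auto simp: in_keys_iff Const_def\<close>)

lemma Const_simps:
  "Const 0 = 0" "Const 1 = 1" "Const (a + b) = Const a + Const (b::'a::comm_ring_1)"
  "Const (a * b) = Const a * Const b"
  by (auto simp: Const_def single_add mult_single)

lemma subst_poly_add: "subst_poly \<sigma> (f + g) = subst_poly \<sigma> f + subst_poly \<sigma> g"
proof -
  let ?A = "Poly_Mapping.keys f \<union> Poly_Mapping.keys g"
  have "Poly_Mapping.keys (f + g) \<subseteq> ?A" by (rule Poly_Mapping.keys_add)
  then show ?thesis
    by (simp add: subst_poly_superset[of ?A] lookup_add Const_simps algebra_simps sum.distrib)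
qed

lemma subst_poly_0: "subst_poly \<sigma> 0 = 0"
  by (simp add: subst_poly_def)

lemma subst_poly_sum: "subst_poly \<sigma> (sum f A) = (\<Sum>x\<in>A. subst_poly \<sigma> (f x))"
  by (induction A rule: infinite_finite_induct) (auto simp: subst_poly_add subst_poly_0)

lemma subst_poly_single: "subst_poly \<sigma> (Poly_Mapping.single k c) =
   Const c * (\<Prod>i \<in> Poly_Mapping.keys k. \<sigma> i ^ Poly_Mapping.lookup k i)"
  by (cases "c = 0") (auto simp: subst_poly_def Const_simps)

lemma monomial_prod_add:
  fixes \<sigma> :: "nat \<Rightarrow> 'b::comm_monoid_mult"
  shows "(\<Prod>i \<in> Poly_Mapping.keys (k + l). \<sigma> i ^ Poly_Mapping.lookup (k + l) i) =
    (\<Prod>i \<in> Poly_Mapping.keys k. \<sigma> i ^ Poly_Mapping.lookup k i) *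
    (\<Prod>i \<in> Poly_Mapping.keys l. \<sigma> i ^ Poly_Mapping.lookup l i)"
proof -
  let ?A = "Poly_Mapping.keys k \<union> Poly_Mapping.keys l"
  have *: "(\<Prod>i \<in> Poly_Mapping.keys m. \<sigma> i ^ Poly_Mapping.lookup m i) =
           (\<Prod>i \<in> ?A. \<sigma> i ^ Poly_Mapping.lookup m i)" if "Poly_Mapping.keys m \<subseteq> ?A" for m
    by (rule prod.mono_neutral_left) (use that in \<open>auto simp: in_keys_iff\<close>)
  have "Poly_Mapping.keys (k + l) \<subseteq> ?A" by (rule Poly_Mapping.keys_add)
  from *[OF this] show ?thesis
    by (simp add: *[of k] *[of l] lookup_add power_add prod.distrib)
qed

lemma subst_poly_mult: "subst_poly \<sigma> (f * g) = subst_poly \<sigma> f * subst_poly \<sigma> g"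
proof -
  let ?s = "\<lambda>f. (\<Sum>k \<in> Poly_Mapping.keys f. Poly_Mapping.single k (Poly_Mapping.lookup f k))"
  have "subst_poly \<sigma> (?s f * ?s g) = subst_poly \<sigma> (?s f) * subst_poly \<sigma> (?s g)"
    by (simp add: sum_product subst_poly_sum subst_poly_single mult_single monomial_prod_add
        Const_simps algebra_simps)
  then show ?thesis by (simp add: sum_monomials)
qed

lemma subst_poly_Const: "subst_poly \<sigma> (Const c) = Const c"
  unfolding Const_def[of c] subst_poly_single by (simp add: Const_def)

lemma subst_poly_1: "subst_poly \<sigma> 1 = 1"
  using subst_poly_Const[of \<sigma> 1] by (simp add: Const_simps)

lemma subst_poly_Var: "subst_poly \<sigma> (Var i) = \<sigma> i"
  by (simp add: Var_def subst_poly_single Const_simps)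

lemma subst_poly_power: "subst_poly \<sigma> (f ^ k) = subst_poly \<sigma> f ^ k"
  by (induction k) (auto simp: subst_poly_1 subst_poly_mult)

lemma subst_poly_prod: "subst_poly \<sigma> (prod f A) = (\<Prod>x\<in>A. subst_poly \<sigma> (f x))"
  by (induction A rule: infinite_finite_induct) (auto simp: subst_poly_mult subst_poly_1)

lemma subst_poly_subst_poly: "subst_poly \<sigma> (subst_poly \<tau> f) = subst_poly (\<lambda>i. subst_poly \<sigma> (\<tau> i)) f"
  unfolding subst_poly_def[of \<tau>] subst_poly_def[of "\<lambda>i. subst_poly \<sigma> (\<tau> i)"]
  by (simp add: subst_poly_sum subst_poly_mult subst_poly_Const subst_poly_prod subst_poly_power)

lemma prod_Var: "(\<Prod>i \<in> Poly_Mapping.keys k. Var i ^ Poly_Mapping.lookup k i)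
    = (Poly_Mapping.single k 1 :: 'a::comm_ring_1 mpoly)"
proof -
  have 1: "(Var i :: 'a mpoly) ^ c = Poly_Mapping.single (Poly_Mapping.single i c) 1" for i c
    by (induction c) (auto simp: Var_def mult_single simp flip: single_add)
  have 2: "(\<Prod>i\<in>A. Poly_Mapping.single (f i) 1) = (Poly_Mapping.single (sum f A) 1 :: 'a mpoly)"
    for A and f :: "nat \<Rightarrow> nat \<Rightarrow>\<^sub>0 nat"
    by (induction A rule: infinite_finite_induct) (auto simp: mult_single)
  show ?thesis by (simp add: 1 2 sum_monomials)
qed

lemma subst_poly_id: "subst_poly Var f = f"
  by (simp add: subst_poly_def prod_Var Const_def mult_single sum_monomials)

lemma lin_subst_lin_subst:
  assumes "A \<in> carrier_mat n n" "B \<in> carrier_mat n n"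
  shows "subst_poly (lin_subst n B) (lin_subst n A i) = lin_subst n (A * B) i"
proof (cases "i \<in> {1..n}")
  case True
  have C: "Const (sum f S) = (\<Sum>x\<in>S. Const (f x :: 'a))" for f and S :: "nat set"
    by (induction S rule: infinite_finite_induct) (auto simp: Const_simps)
  have AB: "(A * B) $$ (i - 1, k - 1) = (\<Sum>j=1..n. A $$ (i - 1, j - 1) * B $$ (j - 1, k - 1))"
    if "k \<in> {1..n}" for k
  proof -
    have "(A * B) $$ (i - 1, k - 1) = (\<Sum>j<n. A $$ (i - 1, j) * B $$ (j, k - 1))"
      using that True assms
      by (subst index_mult_mat) (auto simp: scalar_prod_def atLeast0LessThan intro!: sum.cong)
    also have "\<dots> = (\<Sum>j=1..n. A $$ (i - 1, j - 1) * B $$ (j - 1, k - 1))"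
      by (rule sum.reindex_bij_witness[of _ "\<lambda>j. j - 1" Suc]) auto
    finally show ?thesis .
  qed
  have "subst_poly (lin_subst n B) (lin_subst n A i) =
    (\<Sum>j=1..n. Const (A $$ (i - 1, j - 1)) * (\<Sum>k=1..n. Const (B $$ (j - 1, k - 1)) * Var k))"
    using True
    by (auto simp: lin_subst_def subst_poly_sum subst_poly_mult subst_poly_Const subst_poly_Var
        intro!: sum.cong)
  also have "\<dots> = (\<Sum>k=1..n. \<Sum>j=1..n.
      Const (A $$ (i - 1, j - 1)) * (Const (B $$ (j - 1, k - 1)) * Var k))"
    by (subst sum.swap) (simp add: sum_distrib_left)
  also have "\<dots> = (\<Sum>k=1..n. Const ((A * B) $$ (i - 1, k - 1)) * Var k)"
    by (intro sum.cong refl) (simp only: AB C Const_simps sum_distrib_right mult.assoc)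
  also have "\<dots> = lin_subst n (A * B) i"
    using True by (simp add: lin_subst_def)
  finally show ?thesis .
next
  case False
  then have "lin_subst n M i = Var i" for M :: "'a mat"
    unfolding lin_subst_def by (rule if_not_P)
  then show ?thesis by (simp only: subst_poly_Var)
qed

lemma lin_subst_one: "lin_subst n (1\<^sub>m n) = Var"
proof
  fix i
  have "(\<Sum>j=1..n. Const (1\<^sub>m n $$ (i - 1, j - 1)) * Var j) = (Var i :: 'a mpoly)" if "i \<in> {1..n}"
  proof -
    have "(\<Sum>j=1..n. Const (1\<^sub>m n $$ (i - 1, j - 1)) * Var j)
        = (\<Sum>j=1..n. if j = i then (Var j :: 'a mpoly) else 0)"
      using that by (intro sum.cong) (auto simp: Const_simps)
    also have "\<dots> = Var i" using that by simp
    finally show ?thesis .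
  qed
  then show "lin_subst n (1\<^sub>m n) i = (Var i :: 'a mpoly)" by (simp add: lin_subst_def)
qed

lemma group_GL: "group (GL n :: 'a::field mat monoid)"
proof -
  interpret ring "ring_mat TYPE('a) n ()" by (rule ring_mat)
  show ?thesis unfolding GL_def by (rule units_group)
qed

lemma GL_simps:
  "\<one>\<^bsub>GL n\<^esub> = 1\<^sub>m n" "x \<otimes>\<^bsub>GL n\<^esub> y = x * y"
  "x \<in> carrier (GL n) \<Longrightarrow> x \<in> carrier_mat n n"
  by (auto simp: GL_def units_of_def ring_mat_def Units_def)

lemma act_poly_mult:
  assumes "g \<in> carrier (GL n)" "k \<in> carrier (GL n)"
  shows "act_poly n (g * k) f = act_poly n g (act_poly n k f)"
proof -
  interpret GL: group "GL n :: 'a mat monoid" by (rule group_GL)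
  have "inv\<^bsub>GL n\<^esub> (g * k) = inv\<^bsub>GL n\<^esub> k * inv\<^bsub>GL n\<^esub> g"
    using GL.inv_mult_group[OF assms] by (simp add: GL_simps)
  then show ?thesis
    using assms
    by (simp add: act_poly_def subst_poly_subst_poly lin_subst_lin_subst GL_simps)
qed

lemma act_poly_one: "act_poly n (1\<^sub>m n) f = f"
proof -
  interpret GL: group "GL n :: 'a mat monoid" by (rule group_GL)
  have "inv\<^bsub>GL n\<^esub> (1\<^sub>m n) = (1\<^sub>m n :: 'a mat)"
    using GL.inv_one by (simp add: GL_simps)
  then show ?thesis by (simp add: act_poly_def lin_subst_one subst_poly_id)
qed

lemma act_poly_eq_0_iff:
  assumes "g \<in> carrier (GL n)"
  shows "act_poly n g f = 0 \<longleftrightarrow> f = 0"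
proof
  interpret GL: group "GL n :: 'a mat monoid" by (rule group_GL)
  assume "act_poly n g f = 0"
  then have "act_poly n (inv\<^bsub>GL n\<^esub> g * g) f = 0"
    using assms by (simp add: act_poly_mult) (simp add: act_poly_def subst_poly_0)
  moreover have "inv\<^bsub>GL n\<^esub> g * g = 1\<^sub>m n"
    using GL.l_inv[OF assms] by (simp add: GL_simps)
  ultimately show "f = 0" by (simp add: act_poly_one)
qed (simp add: act_poly_def subst_poly_0)

lemma act_fract_Fract:
  assumes "g \<in> carrier (GL n)" "b \<noteq> 0"
  shows "act_fract n g (Fract a b) = Fract (act_poly n g a) (act_poly n g b)"
  unfolding act_fract_def
proof (rule the_equality)
  fix s assume "\<exists>a' b'. b' \<noteq> 0 \<and> Fract a b = Fract a' b' \<and>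
    s = Fract (act_poly n g a') (act_poly n g b')"
  then obtain a' b' where *: "b' \<noteq> 0" "Fract a b = Fract a' b'"
    "s = Fract (act_poly n g a') (act_poly n g b')" by blast
  then have "act_poly n g (a * b') = act_poly n g (a' * b)"
    using assms by (simp add: eq_fract)
  then have "act_poly n g a * act_poly n g b' = act_poly n g a' * act_poly n g b"
    by (simp add: act_poly_def subst_poly_mult)
  then show "s = Fract (act_poly n g a) (act_poly n g b)"
    using * assms by (simp add: eq_fract act_poly_eq_0_iff)
qed (use assms in blast)

lemma CHAR_finite_field:
  assumes "prime p" "CARD('a::{field,finite}) = (p ^ e)\<^sup>2"
  shows "CHAR('a) = p"
proof -
  have "CHAR('a) > 0" by (rule finite_imp_CHAR_pos) simp
  then have "prime CHAR('a)" by (rule prime_CHAR_semidom)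
  moreover have "CHAR('a) dvd p ^ (e * 2)"
    using CHAR_dvd_CARD[where 'a = 'a] assms(2) by (simp add: power_mult)
  ultimately show ?thesis
    using assms(1) prime_dvd_power primes_dvd_imp_eq by blast
qed

lemma bar_mult:
  assumes "prime CHAR('a::field)" "q = CHAR('a) ^ e"
    and "A \<in> carrier_mat n n" "B \<in> carrier_mat n n"
  shows "bar q (A * B) = bar q A * (bar q B :: 'a mat)"
  by (rule eq_matI)
    (use assms in \<open>auto simp: bar_def scalar_prod_def freshmans_dream_sum'[OF assms(1) refl]
      power_mult_distrib intro!: sum.cong\<close>)

lemma finite_carrier_mat: "finite (carrier_mat n n :: 'a::finite mat set)"
proof (rule finite_subset)
  let ?F = "PiE ({..<n} \<times> {..<n}) (\<lambda>_. UNIV :: 'a set)"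
  show "carrier_mat n n \<subseteq> mat n n ` ?F"
  proof
    fix A :: "'a mat" assume A: "A \<in> carrier_mat n n"
    have "mat n n (restrict (\<lambda>ij. A $$ ij) ({..<n} \<times> {..<n})) = A"
      by (rule eq_matI) (use A in simp_all)
    moreover have "restrict (\<lambda>ij. A $$ ij) ({..<n} \<times> {..<n}) \<in> ?F"
      by (rule restrict_PiE_iff[THEN iffD2]) blast
    ultimately show "A \<in> mat n n ` ?F" by (metis image_eqI)
  qed
  have "finite ?F" by (rule finite_PiE) simp_all
  then show "finite (mat n n ` ?F)" by (rule finite_imageI)
qed

lemma (in group) finite_closed_subgroup:
  assumes "H \<subseteq> carrier G" "finite H" "\<one> \<in> H" "\<And>x y. x \<in> H \<Longrightarrow> y \<in> H \<Longrightarrow> x \<otimes> y \<in> H"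
  shows "subgroup H G"
proof (rule subgroupI)
  fix x assume x: "x \<in> H"
  have xc: "x \<in> carrier G" using assms(1) x by blast
  have HC: "y \<in> carrier G" if "y \<in> H" for y using assms(1) that by blast
  have "inj_on ((\<otimes>) x) H"
    by (rule inj_onI) (simp add: HC xc l_cancel)
  moreover have "(\<otimes>) x ` H \<subseteq> H" using assms(4) x by blast
  ultimately have "(\<otimes>) x ` H = H"
    using assms(2) by (intro endo_inj_surj)
  then have "\<one> \<in> (\<otimes>) x ` H" using assms(3) by (simp only:)
  then obtain y where y: "y \<in> H" "x \<otimes> y = \<one>" by (metis imageE)
  then have "inv y = x" using xc HC by (intro inv_equality)
  then have "inv x = y" using HC[OF y(1)] inv_inv by blast
  then show "inv x \<in> H" using y(1) by simp
qed (use assms(1,3,4) in \<open>blast+\<close>)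

lemma lower_unitriangular_in_GL: "lower_unitriangular n \<subseteq> carrier (GL n)"
proof
  fix A :: "'a mat" assume A: "A \<in> lower_unitriangular n"
  then have "det A = prod_list (diag_mat A)"
    by (intro det_lower_triangular[of n A]) (auto simp: lower_unitriangular_def)
  also have "diag_mat A = map (\<lambda>i. 1) [0..<n]"
    using A by (auto simp: diag_mat_def lower_unitriangular_def)
  finally have "det A = 1" by (simp add: map_replicate_const)
  then show "A \<in> carrier (GL n)"
    using A det_non_zero_imp_unit[of A n "()"]
    by (simp add: GL_def units_of_carrier lower_unitriangular_def)
qed

lemma lower_unitriangular_mult:
  assumes "A \<in> lower_unitriangular n" "B \<in> lower_unitriangular n"
  shows "A * B \<in> lower_unitriangular n"
proof -
  have AB: "A \<in> carrier_mat n n" "B \<in> carrier_mat n n"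
    using assms by (auto simp: lower_unitriangular_def)
  have eq: "(A * B) $$ (i,j) = (\<Sum>k<n. A $$ (i,k) * B $$ (k,j))" if "i < n" "j < n" for i j
    using that AB by (auto simp: scalar_prod_def atLeast0LessThan intro!: sum.cong)
  have "(A * B) $$ (i,j) = 0" if "i < j" "j < n" for i j
  proof -
    have "A $$ (i,k) * B $$ (k,j) = 0" if "k < n" for k
      using assms \<open>i < j\<close> \<open>j < n\<close> that by (cases "i < k") (auto simp: lower_unitriangular_def)
    then show ?thesis using that by (simp add: eq del: mult_eq_0_iff)
  qed
  moreover have "(A * B) $$ (i,i) = 1" if "i < n" for i
  proof -
    have "A $$ (i,k) * B $$ (k,i) = (if k = i then 1 else 0)" if "k < n" for k
      using assms \<open>i < n\<close> that
      by (cases i k rule: linorder_cases) (auto simp: lower_unitriangular_def)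
    then show ?thesis using that by (simp add: eq)
  qed
  ultimately show ?thesis using AB by (simp add: lower_unitriangular_def)
qed

lemma unitary_mult:
  assumes "prime CHAR('a::field)" "q = CHAR('a) ^ e"
    and A: "A \<in> carrier_mat n n" and B: "B \<in> carrier_mat n n"
    and "transpose_mat A * antidiag n * bar q A = antidiag n"
    and "transpose_mat B * antidiag n * bar q B = (antidiag n :: 'a mat)"
  shows "transpose_mat (A * B) * antidiag n * bar q (A * B) = antidiag n"
proof -
  let ?J = "antidiag n :: 'a mat"
  have J: "?J \<in> carrier_mat n n" by (simp add: antidiag_def)
  have bar: "bar q A \<in> carrier_mat n n" "bar q B \<in> carrier_mat n n"
    using A B by (auto simp: bar_def)
  have T: "transpose_mat A \<in> carrier_mat n n" "transpose_mat B \<in> carrier_mat n n"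
    using A B by auto
  have "transpose_mat (A * B) * ?J * bar q (A * B)
      = transpose_mat B * (transpose_mat A * ?J * bar q A) * bar q B"
    using A B J bar T
    by (simp add: transpose_mult[OF A B] bar_mult[OF assms(1-4)] assoc_mult_mat[of _ n n _ n _ n])
  then show ?thesis using assms by simp
qed

lemma
  fixes n q p e :: nat
  assumes "prime p" "q = p ^ e" "CARD('a::{field,finite}) = q\<^sup>2"
  shows subgroup_GU: "subgroup (carrier (GU q n)) (GL n :: 'a mat monoid)"
    and subgroup_sylow_GU: "subgroup (carrier (sylow_GU q n)) (GL n :: 'a mat monoid)"
    and sylow_GU_subset_GU: "carrier (sylow_GU q n) \<subseteq> carrier (GU q n :: 'a mat monoid)"
proof -
  interpret GL: group "GL n :: 'a mat monoid" by (rule group_GL)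
  have C: "CHAR('a) = p" using CHAR_finite_field[where 'a = 'a] assms by simp
  have one: "transpose_mat (1\<^sub>m n) * antidiag n * bar q (1\<^sub>m n) = (antidiag n :: 'a mat)"
  proof -
    have "bar q (1\<^sub>m n) = (1\<^sub>m n :: 'a mat)"
      using assms(1,2) by (auto simp: bar_def intro!: eq_matI dest: prime_gt_0_nat)
    then show ?thesis by (simp add: antidiag_def)
  qed
  have fin: "finite H" if "H \<subseteq> carrier (GL n)" for H :: "'a mat set"
    by (rule finite_subset[OF _ finite_carrier_mat[of n]]) (use that GL_simps(3) in blast)
  have mult: "transpose_mat (A * B) * antidiag n * bar q (A * B) = (antidiag n :: 'a mat)"
    if "A \<in> carrier (GL n)" "B \<in> carrier (GL n)"
      "transpose_mat A * antidiag n * bar q A = antidiag n"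
      "transpose_mat B * antidiag n * bar q B = antidiag n" for A B :: "'a mat"
    by (rule unitary_mult[of q e]) (use that assms C GL_simps(3) in auto)
  show sub: "carrier (sylow_GU q n) \<subseteq> carrier (GU q n :: 'a mat monoid)"
    using lower_unitriangular_in_GL by (auto simp: sylow_GU_def GU_def)
  show "subgroup (carrier (GU q n)) (GL n :: 'a mat monoid)"
    by (rule GL.finite_closed_subgroup)
      (use one mult fin GL.m_closed GL.one_closed in \<open>auto simp: GU_def GL_simps(1,2)\<close>)
  show "subgroup (carrier (sylow_GU q n)) (GL n :: 'a mat monoid)"
  proof (rule GL.finite_closed_subgroup)
    show *: "carrier (sylow_GU q n) \<subseteq> carrier (GL n :: 'a mat monoid)"
      using lower_unitriangular_in_GL by (auto simp: sylow_GU_def)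
    show "finite (carrier (sylow_GU q n) :: 'a mat set)" by (rule fin[OF *])
    show "\<one>\<^bsub>GL n\<^esub> \<in> (carrier (sylow_GU q n) :: 'a mat set)"
      using one by (auto simp: sylow_GU_def GL_simps lower_unitriangular_def)
    show "x \<otimes>\<^bsub>GL n\<^esub> y \<in> carrier (sylow_GU q n)"
      if "x \<in> carrier (sylow_GU q n)" "y \<in> carrier (sylow_GU q n)" for x y :: "'a mat"
      using that mult lower_unitriangular_in_GL lower_unitriangular_mult
      by (auto simp: sylow_GU_def GL_simps(2))
  qed
qed

lemma orbit_product_Var_1:
  fixes n q p e :: nat
  assumes "prime p" "q = p ^ e" "CARD('a::{field,finite}) = q\<^sup>2" "n \<ge> 1"
  shows "orbit_product (sylow_GU q n) n (Var 1) = (Var 1 :: 'a mpoly)"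
proof -
  let ?G = "sylow_GU q n :: 'a mat monoid"
  have sub: "subgroup (carrier ?G) (GL n)" using assms(1-3) by (rule subgroup_sylow_GU)
  have fix1: "act_poly n g (Var 1) = (Var 1 :: 'a mpoly)" if "g \<in> carrier ?G" for g
  proof -
    have "inv\<^bsub>GL n\<^esub> g \<in> carrier ?G"
      using subgroup.m_inv_closed[OF sub that] .
    then have L: "inv\<^bsub>GL n\<^esub> g \<in> lower_unitriangular n" by (simp add: sylow_GU_def)
    have "act_poly n g (Var 1) = (\<Sum>j=1..n. Const ((inv\<^bsub>GL n\<^esub> g) $$ (0, j - 1)) * Var j)"
      using assms(4) by (simp add: act_poly_def subst_poly_Var lin_subst_def)
    also have "\<dots> = (\<Sum>j=1..n. if j = 1 then Var j else 0)"
      using L by (intro sum.cong) (auto simp: lower_unitriangular_def Const_simps)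
    also have "\<dots> = Var 1" using assms(4) by simp
    finally show ?thesis .
  qed
  have "carrier ?G \<noteq> {}" using subgroup.one_closed[OF sub] by blast
  then have "orbit ?G (act_poly n) (Var 1) = {Var 1}"
    using fix1 unfolding orbit_def by force
  then show ?thesis by (simp add: orbit_product_def)
qed

lemma polys_in_Const: "Const c \<in> polys_in n"
  by (auto simp: polys_in_def Const_def)

lemma polys_in_add: "f \<in> polys_in n \<Longrightarrow> g \<in> polys_in n \<Longrightarrow> f + g \<in> polys_in n"
  using Poly_Mapping.keys_add[of f g] unfolding polys_in_def by blast

lemma polys_in_uminus: "f \<in> polys_in n \<Longrightarrow> - f \<in> polys_in n"
  for f :: "'a::comm_ring_1 mpoly"
  by (simp add: polys_in_def)

lemma polys_in_mult:
  fixes f g :: "'a::comm_ring_1 mpoly"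
  assumes "f \<in> polys_in n" "g \<in> polys_in n"
  shows "f * g \<in> polys_in n"
  unfolding polys_in_def
proof safe
  fix k i assume "k \<in> Poly_Mapping.keys (f * g)" and i: "i \<in> Poly_Mapping.keys k"
  then obtain a b where "a \<in> Poly_Mapping.keys f" "b \<in> Poly_Mapping.keys g" "k = a + b"
    using keys_mult[of f g] by blast
  then show "i \<in> {1..n}"
    using i Poly_Mapping.keys_add[of a b] assms unfolding polys_in_def by blast
qed

lemma field_function_field: "field (function_field n :: 'a::field mpoly fract ring)"
proof -
  let ?R = "ring_of_type_algebra :: 'a mpoly fract ring"
  let ?K = "{Fract a b | a b. a \<in> polys_in n \<and> b \<in> polys_in n \<and> b \<noteq> (0 :: 'a mpoly)}"
  interpret R: field ?R by (rule field_from_type_algebra)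
  have one: "(1 :: 'a mpoly) \<in> polys_in n" "(0 :: 'a mpoly) \<in> polys_in n"
    using polys_in_Const[of "1::'a" n] polys_in_Const[of "0::'a" n]
    by (simp_all only: Const_simps)
  have "subfield ?K ?R"
  proof (rule R.subfieldI')
    show "subring ?K ?R"
    proof (rule R.subringI)
      show "?K \<subseteq> carrier ?R" by (simp add: ring_of_type_algebra_def)
      show "\<one>\<^bsub>?R\<^esub> \<in> ?K"
        using one zero_neq_one[where 'a = "'a mpoly"]
        by (auto simp: ring_of_type_algebra_def One_fract_def
            intro!: exI[of _ "1 :: 'a mpoly"] simp del: zero_neq_one)
      fix x assume x: "x \<in> ?K"
      then obtain a b where ab: "x = Fract a b" "a \<in> polys_in n" "b \<in> polys_in n" "b \<noteq> 0" by blast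
      have "\<ominus>\<^bsub>?R\<^esub> x = - x"
        by (rule R.minus_equality) (simp_all add: ring_of_type_algebra_def)
      moreover have "- x \<in> ?K" using ab polys_in_uminus by auto
      ultimately show "\<ominus>\<^bsub>?R\<^esub> x \<in> ?K" by simp
      fix y assume "y \<in> ?K"
      then obtain c d where cd: "y = Fract c d" "c \<in> polys_in n" "d \<in> polys_in n" "d \<noteq> 0" by blast
      have "Fract (a * c) (b * d) \<in> ?K" "Fract (a * d + c * b) (b * d) \<in> ?K"
      proof -
        have *: "b * d \<noteq> 0" "a * c \<in> polys_in n" "b * d \<in> polys_in n"
          "a * d + c * b \<in> polys_in n"
          using ab cd by (auto intro!: polys_in_mult polys_in_add)
        show "Fract (a * c) (b * d) \<in> ?K" using * by blast
        show "Fract (a * d + c * b) (b * d) \<in> ?K" using * by blast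
      qed
      then show "x \<otimes>\<^bsub>?R\<^esub> y \<in> ?K" "x \<oplus>\<^bsub>?R\<^esub> y \<in> ?K"
        using ab cd by (simp_all add: ring_of_type_algebra_def)
    qed
    fix x assume x: "x \<in> ?K - {\<zero>\<^bsub>?R\<^esub>}"
    then obtain a b where ab: "x = Fract a b" "a \<in> polys_in n" "b \<in> polys_in n" "b \<noteq> 0" by blast
    have nz: "x \<noteq> 0" using x by (simp add: ring_of_type_algebra_def)
    then have "inv\<^bsub>?R\<^esub> x = inverse x"
      by (intro R.comm_inv_char) (simp_all add: ring_of_type_algebra_def)
    moreover have "a \<noteq> 0" using nz ab by (auto simp: Zero_fract_def eq_fract)
    then have "inverse x \<in> ?K" using ab by auto
    ultimately show "inv\<^bsub>?R\<^esub> x \<in> ?K" by simp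
  qed
  then show ?thesis
    using R.subfield_iff(2) by (simp add: function_field_def)
qed

end

theory Submission
  imports Defs
begin

text \<open>
  Let \<open>K\<close> be the field generated by the listed invariants and \<open>L\<^sub>i = K(x\<^sub>1, \<dots>, x\<^sub>i)\<close>. An invariant
  in \<open>L\<^sub>i\<close> already lies in \<open>L\<^bsub>i-1\<^esub>\<close> as soon as \<open>x\<^sub>i\<close> is a root of a nonzero polynomial over
  \<open>L\<^bsub>i-1\<^esub>\<close> whose degree is at most the number of images of \<open>x\<^sub>i\<close> under the pointwise stabilizer
  of \<open>x\<^sub>1, \<dots>, x\<^bsub>i-1\<^esub>\<close>; so it suffices to exhibit such polynomials and enough stabilizer elements.

  For \<open>i \<le> m + 1\<close> the polynomial is the product over the orbit of \<open>x\<^sub>i\<close>, shifted by \<open>N(x\<^sub>i)\<close>.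
  For \<open>i = 2m + 1 - r\<close> with \<open>r < m\<close>, the equations \<open>h\<^sub>1, \<dots>, h\<^sub>r\<close> and their Frobenius twists pair the
  vectors \<open>(x\<^sub>j)\<close> and \<open>(x\<^bsub>2m+1-j\<^esub>)\<close>, \<open>j \<le> r\<close>; inverting a Moore matrix in \<open>x\<^sub>1, \<dots>, x\<^sub>r\<close> eliminates
  all unknowns but \<open>x\<^sub>i\<close> and leaves a polynomial of degree at most \<open>q\<^bsup>2r-1\<^esup>\<close>, which is
  the number of images of \<open>x\<^sub>i\<close>.
\<close>

section \<open>Descending invariants along a tower of simple extensions\<close>

text \<open>A set inside a type-class field, so that the type-level \<open>poly\<close> and its root
  bounds apply to polynomials with coefficients in the set. Closure under \<open>inverse\<close> can
  include 0 because \<open>inverse 0 = 0\<close>.\<close>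

definition subfield_set :: "'b::field set \<Rightarrow> bool" where
  "subfield_set L \<longleftrightarrow> 0 \<in> L \<and> 1 \<in> L \<and> (\<forall>x\<in>L. \<forall>y\<in>L. x + y \<in> L \<and> x * y \<in> L)
     \<and> (\<forall>x\<in>L. - x \<in> L \<and> inverse x \<in> L)"

lemma subfield_setD:
  assumes "subfield_set L"
  shows "0 \<in> L" "1 \<in> L"
    "x \<in> L \<Longrightarrow> y \<in> L \<Longrightarrow> x + y \<in> L" "x \<in> L \<Longrightarrow> y \<in> L \<Longrightarrow> x * y \<in> L"
    "x \<in> L \<Longrightarrow> - x \<in> L" "x \<in> L \<Longrightarrow> inverse x \<in> L"
    "x \<in> L \<Longrightarrow> y \<in> L \<Longrightarrow> x - y \<in> L" "x \<in> L \<Longrightarrow> y \<in> L \<Longrightarrow> x / y \<in> L"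
    "x \<in> L \<Longrightarrow> x ^ k \<in> L"
proof -
  show *: "0 \<in> L" "1 \<in> L"
    "x \<in> L \<Longrightarrow> y \<in> L \<Longrightarrow> x + y \<in> L" "x \<in> L \<Longrightarrow> y \<in> L \<Longrightarrow> x * y \<in> L"
    "x \<in> L \<Longrightarrow> - x \<in> L" "x \<in> L \<Longrightarrow> inverse x \<in> L" for x y
    using assms unfolding subfield_set_def by blast+
  show "x \<in> L \<Longrightarrow> y \<in> L \<Longrightarrow> x - y \<in> L"
    using *(3)[of x "- y"] *(5) by simp
  show "x \<in> L \<Longrightarrow> y \<in> L \<Longrightarrow> x / y \<in> L"
    using *(4)[of x "inverse y"] *(6) by (simp add: divide_inverse)
  show "x \<in> L \<Longrightarrow> x ^ k \<in> L"
    by (induction k) (use * in auto)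
qed

lemma subfield_set_sum:
  assumes "subfield_set L" "\<And>i. i \<in> I \<Longrightarrow> f i \<in> L"
  shows "sum f I \<in> L"
  using assms(2) by (induction I rule: infinite_finite_induct) (auto intro: subfield_setD[OF assms(1)])

lemma subfield_set_prod:
  assumes "subfield_set L" "\<And>i. i \<in> I \<Longrightarrow> f i \<in> L"
  shows "prod f I \<in> L"
  using assms(2) by (induction I rule: infinite_finite_induct) (auto intro: subfield_setD[OF assms(1)])

section \<open>Polynomials over a subfield and simple extensions\<close>

definition polys_over :: "'b::zero set \<Rightarrow> 'b poly set" where
  "polys_over L = {A. \<forall>k. Polynomial.coeff A k \<in> L}"

lemma polys_over_closed:
  assumes "subfield_set L"
  shows "0 \<in> polys_over L" "1 \<in> polys_over L" "c \<in> L \<Longrightarrow> [:c:] \<in> polys_over L"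
    "c \<in> L \<Longrightarrow> Polynomial.monom c k \<in> polys_over L" "c \<in> L \<Longrightarrow> [:c, 1:] \<in> polys_over L"
    "A \<in> polys_over L \<Longrightarrow> B \<in> polys_over L \<Longrightarrow> A + B \<in> polys_over L"
    "A \<in> polys_over L \<Longrightarrow> B \<in> polys_over L \<Longrightarrow> A - B \<in> polys_over L"
    "A \<in> polys_over L \<Longrightarrow> - A \<in> polys_over L"
    "A \<in> polys_over L \<Longrightarrow> B \<in> polys_over L \<Longrightarrow> A * B \<in> polys_over L"
  using subfield_setD[OF assms]
  by (auto simp: polys_over_def coeff_pCons coeff_mult split: nat.splits
      intro!: subfield_set_sum[OF assms])

lemma polys_over_sum:
  assumes "subfield_set L" "\<And>i. i \<in> I \<Longrightarrow> f i \<in> polys_over L"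
  shows "sum f I \<in> polys_over L"
  using assms(2)
  by (induction I rule: infinite_finite_induct) (auto intro: polys_over_closed[OF assms(1)])

lemma polys_over_prod:
  assumes "subfield_set L" "\<And>i. i \<in> I \<Longrightarrow> f i \<in> polys_over L"
  shows "prod f I \<in> polys_over L"
  using assms(2)
  by (induction I rule: infinite_finite_induct) (auto intro: polys_over_closed[OF assms(1)])

text \<open>The field L(y) as the values of rational functions at y, a form that covers algebraic
  and transcendental y alike.\<close>

definition simple_ext :: "'b::field set \<Rightarrow> 'b \<Rightarrow> 'b set" where
  "simple_ext L y = {poly A y / poly B y | A B.
     A \<in> polys_over L \<and> B \<in> polys_over L \<and> poly B y \<noteq> 0}"

lemma simple_extI:
  "A \<in> polys_over L \<Longrightarrow> B \<in> polys_over L \<Longrightarrow> poly B y \<noteq> 0 \<Longrightarrow> poly A y / poly B y = z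
    \<Longrightarrow> z \<in> simple_ext L y"
  unfolding simple_ext_def by blast

lemma simple_ext:
  assumes L: "subfield_set L"
  shows "subfield_set (simple_ext L y)" "L \<subseteq> simple_ext L y" "y \<in> simple_ext L y"
proof -
  note [intro] = polys_over_closed[OF L]
  show sub: "L \<subseteq> simple_ext L y"
  proof
    fix c assume "c \<in> L"
    then show "c \<in> simple_ext L y"
      by (intro simple_extI[of "[:c:]" _ 1]) auto
  qed
  show "y \<in> simple_ext L y"
    by (rule simple_extI[of "[:0, 1:]" _ 1]) (use subfield_setD[OF L] in auto)
  have "x + z \<in> simple_ext L y \<and> x * z \<in> simple_ext L y \<and> - x \<in> simple_ext L y
      \<and> inverse x \<in> simple_ext L y" if xz: "x \<in> simple_ext L y" "z \<in> simple_ext L y" for x z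
  proof -
    obtain A B where x: "x = poly A y / poly B y" "A \<in> polys_over L" "B \<in> polys_over L"
      "poly B y \<noteq> 0" using xz(1) unfolding simple_ext_def by blast
    obtain C D where z: "z = poly C y / poly D y" "C \<in> polys_over L" "D \<in> polys_over L"
      "poly D y \<noteq> 0" using xz(2) unfolding simple_ext_def by blast
    have "x + z \<in> simple_ext L y"
      by (rule simple_extI[of "A * D + C * B" _ "B * D"]) (use x z in \<open>auto simp: add_frac_eq\<close>)
    moreover have "x * z \<in> simple_ext L y"
      by (rule simple_extI[of "A * C" _ "B * D"]) (use x z in auto)
    moreover have "- x \<in> simple_ext L y"
      by (rule simple_extI[of "- A" _ "B"]) (use x in auto)
    moreover have "inverse x \<in> simple_ext L y"
    proof (cases "poly A y = 0")
      case True
      then show ?thesis using x sub subfield_setD(1)[OF L] by auto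
    next
      case False
      then show ?thesis by (intro simple_extI[of B _ A]) (use x in auto)
    qed
    ultimately show ?thesis by blast
  qed
  then show "subfield_set (simple_ext L y)"
    using sub subfield_setD(1,2)[OF L] unfolding subfield_set_def by blast
qed

text \<open>Division with remainder by \<open>P\<close>, carried out inside L: the leading
  coefficient of \<open>P\<close> is inverted in L, and subtracting multiples of \<open>P\<close>
  keeps the value at its root \<open>y\<close>.\<close>

lemma reduce_mod_poly:
  assumes L: "subfield_set L" and P: "P \<in> polys_over L" "P \<noteq> 0" "poly P y = 0"
    and A: "A \<in> polys_over L"
  shows "\<exists>A' \<in> polys_over L. poly A' y = poly A y \<and> Polynomial.degree A' < Polynomial.degree P"
  using A
proof (induction "Polynomial.degree A" arbitrary: A rule: less_induct)
  case less
  \<comment> \<open>Having a root makes \<open>P\<close> nonconstant. Hence \<open>A\<close> has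
    positive degree in the second case, and cancelling its leading term lowers the degree even if
    \<open>B = 0\<close>.\<close>
  have dP: "Polynomial.degree P > 0"
    using P by (metis degree_eq_zeroE gr0I pCons_eq_0_iff poly_pCons mult_zero_right add.right_neutral poly_0)
  show ?case
  proof (cases "Polynomial.degree A < Polynomial.degree P")
    case True
    then show ?thesis using less.prems by blast
  next
    case False
    define c where "c = lead_coeff A / lead_coeff P"
    define B where "B = A - Polynomial.monom c (Polynomial.degree A - Polynomial.degree P) * P"
    have "c \<in> L" unfolding c_def
      using less.prems P(1) by (intro subfield_setD[OF L]) (auto simp: polys_over_def)
    then have B: "B \<in> polys_over L" unfolding B_def
      using less.prems P(1) by (intro polys_over_closed[OF L])
    have 1: "Polynomial.degree B \<le> Polynomial.degree A"
      unfolding B_def using False degree_mult_le[of "Polynomial.monom c (Polynomial.degree A - Polynomial.degree P)" P]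
        degree_monom_le[of c "Polynomial.degree A - Polynomial.degree P"]
      by (intro degree_diff_le) auto
    have "Polynomial.coeff B (Polynomial.degree A) = 0"
      using P(2) False by (simp add: B_def coeff_monom_mult c_def)
    then have "Polynomial.degree B < Polynomial.degree A"
      using 1 False dP by (metis leading_coeff_0_iff le_neq_implies_less degree_0 not_less gr0I le_zero_eq)
    from less.hyps[OF this B] obtain A' where "A' \<in> polys_over L" "poly A' y = poly B y"
      "Polynomial.degree A' < Polynomial.degree P" by blast
    moreover have "poly B y = poly A y" by (simp add: B_def P(3))
    ultimately show ?thesis by metis
  qed
qed

section \<open>Ring endomorphisms and descent along one simple extension\<close>

definition ring_endo :: "('b::comm_ring_1 \<Rightarrow> 'b) \<Rightarrow> bool" where
  "ring_endo \<sigma> \<longleftrightarrow> (\<forall>x y. \<sigma> (x + y) = \<sigma> x + \<sigma> y \<and> \<sigma> (x * y) = \<sigma> x * \<sigma> y) \<and> \<sigma> 1 = 1"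

lemma ring_endoD:
  assumes "ring_endo \<sigma>"
  shows "\<sigma> (x + y) = \<sigma> x + \<sigma> y" "\<sigma> (x * y) = \<sigma> x * \<sigma> y" "\<sigma> 1 = 1" "\<sigma> 0 = 0"
    "\<sigma> (- x) = - \<sigma> x" "\<sigma> (x - y) = \<sigma> x - \<sigma> y" "\<sigma> (x ^ k) = \<sigma> x ^ k"
proof -
  show *: "\<sigma> (x + y) = \<sigma> x + \<sigma> y" "\<sigma> (x * y) = \<sigma> x * \<sigma> y" "\<sigma> 1 = 1" for x y
    using assms unfolding ring_endo_def by blast+
  show 0: "\<sigma> 0 = 0" using *(1)[of 0 0] by simp
  show neg: "\<sigma> (- x) = - \<sigma> x" for x
    using *(1)[of x "- x"] 0 by (simp add: eq_neg_iff_add_eq_0 add.commute)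
  show "\<sigma> (x - y) = \<sigma> x - \<sigma> y" using *(1)[of x "- y"] neg by simp
  show "\<sigma> (x ^ k) = \<sigma> x ^ k" by (induction k) (simp_all add: *)
qed

lemma ring_endo_sum: "ring_endo \<sigma> \<Longrightarrow> \<sigma> (sum f I) = (\<Sum>i\<in>I. \<sigma> (f i))"
  by (induction I rule: infinite_finite_induct) (auto simp: ring_endoD)

lemma ring_endo_inverse:
  fixes x :: "'b::field"
  assumes "ring_endo \<sigma>"
  shows "\<sigma> (inverse x) = inverse (\<sigma> x)"
proof (cases "x = 0")
  case False
  then have "\<sigma> x * \<sigma> (inverse x) = 1"
    using ring_endoD(2,3)[OF assms] by (metis right_inverse)
  then show ?thesis by (metis inverse_unique)
qed (simp add: ring_endoD(4)[OF assms])

lemma ring_endo_divide: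
  fixes x :: "'b::field"
  assumes "ring_endo \<sigma>"
  shows "\<sigma> (x / y) = \<sigma> x / \<sigma> y"
  by (simp add: divide_inverse ring_endoD(2)[OF assms] ring_endo_inverse[OF assms])

lemma ring_endo_poly:
  assumes "ring_endo \<sigma>" "\<And>c. c \<in> L \<Longrightarrow> \<sigma> c = c" "A \<in> polys_over L"
  shows "\<sigma> (poly A y) = poly A (\<sigma> y)"
  using assms(2,3) by (simp add: poly_altdef ring_endo_sum ring_endoD assms(1) polys_over_def)

lemma ring_endo_fixes_simple_ext:
  assumes "ring_endo \<sigma>" "\<And>c. c \<in> L \<Longrightarrow> \<sigma> c = c" "\<sigma> y = y" "z \<in> simple_ext L y"
  shows "\<sigma> z = z"
proof -
  obtain A B where "z = poly A y / poly B y" "A \<in> polys_over L" "B \<in> polys_over L"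
    using assms(4) unfolding simple_ext_def by blast
  then show ?thesis
    using assms(1-3) by (simp add: ring_endo_divide ring_endo_poly[where L = L])
qed

text \<open>If \<open>f = A(y)/B(y)\<close> with \<open>A\<close>, \<open>B\<close> reduced modulo \<open>P\<close> is invariant, then
  \<open>A - f B\<close> vanishes at all conjugates of \<open>y\<close>, so it has too many roots.\<close>

lemma invariant_descends:
  fixes f :: "'b::field"
  assumes L: "subfield_set L" and P: "P \<in> polys_over L" "P \<noteq> 0" "poly P y = 0"
    and S: "\<And>\<sigma>. \<sigma> \<in> S \<Longrightarrow> ring_endo \<sigma>" "\<And>\<sigma> c. \<sigma> \<in> S \<Longrightarrow> c \<in> L \<Longrightarrow> \<sigma> c = c"
      "\<And>\<sigma>. \<sigma> \<in> S \<Longrightarrow> \<sigma> f = f"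
    and card: "Polynomial.degree P \<le> card ((\<lambda>\<sigma>. \<sigma> y) ` S)"
    and f: "f \<in> simple_ext L y"
  shows "f \<in> L"
proof -
  obtain A0 B0 where f0: "f = poly A0 y / poly B0 y" "A0 \<in> polys_over L" "B0 \<in> polys_over L"
    "poly B0 y \<noteq> 0" using f unfolding simple_ext_def by blast
  obtain A where A: "A \<in> polys_over L" "poly A y = poly A0 y"
    "Polynomial.degree A < Polynomial.degree P"
    using reduce_mod_poly[OF L P f0(2)] by blast
  obtain B where B: "B \<in> polys_over L" "poly B y = poly B0 y"
    "Polynomial.degree B < Polynomial.degree P"
    using reduce_mod_poly[OF L P f0(3)] by blast
  \<comment> \<open>The coefficients of \<open>D\<close> are only known to lie in L(y), as
    \<open>f\<close> does; what counts is that its degree stays below that of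
    \<open>P\<close>.\<close>
  define D where "D = A - Polynomial.smult f B"
  have dD: "Polynomial.degree D < Polynomial.degree P"
    unfolding D_def using A(3) B(3)
    by (intro degree_diff_less) (auto intro: le_less_trans[OF degree_smult_le])
  have "D = 0"
  proof (rule ccontr)
    assume D: "D \<noteq> 0"
    have "(\<lambda>\<sigma>. \<sigma> y) ` S \<subseteq> {t. poly D t = 0}"
    proof (clarify)
      fix \<sigma> assume \<sigma>: "\<sigma> \<in> S"
      have "f * poly B y = poly A y" using f0 A B by simp
      then have "\<sigma> f * \<sigma> (poly B y) = \<sigma> (poly A y)"
        by (metis ring_endoD(2)[OF S(1)[OF \<sigma>]])
      moreover have "\<sigma> (poly B y) = poly B (\<sigma> y)"
        by (rule ring_endo_poly[OF S(1) S(2)]) (use \<sigma> B(1) in auto)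
      moreover have "\<sigma> (poly A y) = poly A (\<sigma> y)"
        by (rule ring_endo_poly[OF S(1) S(2)]) (use \<sigma> A(1) in auto)
      ultimately show "poly D (\<sigma> y) = 0" using S(3)[OF \<sigma>] by (simp add: D_def)
    qed
    then have "card ((\<lambda>\<sigma>. \<sigma> y) ` S) \<le> card {t. poly D t = 0}"
      by (intro card_mono poly_roots_finite D)
    also have "\<dots> \<le> Polynomial.degree D" by (intro card_poly_roots_bound D)
    finally show False using dD card by simp
  qed
  \<comment> \<open>As \<open>D = 0\<close> is an identity of polynomials, comparing coefficients at
    the degree of \<open>B\<close> exhibits \<open>f\<close> as a quotient of elements of L.\<close>
  have "B \<noteq> 0" using B(2) f0(4) by auto
  moreover have "Polynomial.coeff A (Polynomial.degree B) = f * lead_coeff B"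
    using arg_cong[OF \<open>D = 0\<close>, of "\<lambda>D. Polynomial.coeff D (Polynomial.degree B)"] by (simp add: D_def)
  ultimately have "f = Polynomial.coeff A (Polynomial.degree B) / lead_coeff B" by simp
  then show ?thesis
    using A(1) B(1) subfield_setD(8)[OF L] by (simp add: polys_over_def)
qed

section \<open>Towers of simple extensions\<close>

primrec tower :: "'b::field set \<Rightarrow> (nat \<Rightarrow> 'b) \<Rightarrow> nat \<Rightarrow> 'b set" where
  "tower K x 0 = K"
| "tower K x (Suc i) = simple_ext (tower K x i) (x (Suc i))"

lemma subfield_set_tower: "subfield_set K \<Longrightarrow> subfield_set (tower K x i)"
  by (induction i) (auto intro: simple_ext)

lemma tower_mono:
  assumes "subfield_set K" "i \<le> j"
  shows "tower K x i \<subseteq> tower K x j"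
  using assms(2)
proof (induction rule: dec_induct)
  case (step j)
  then show ?case using simple_ext(2)[OF subfield_set_tower[OF assms(1)], of x j "x (Suc j)"] by simp
qed simp

lemma in_tower:
  assumes "subfield_set K" "j \<in> {1..i}"
  shows "x j \<in> tower K x i"
proof -
  obtain j' where j: "j = Suc j'" using assms(2) by (cases j) auto
  have "x j \<in> tower K x j"
    unfolding j using simple_ext(3)[OF subfield_set_tower[OF assms(1)]] by simp
  then show ?thesis using tower_mono[OF assms(1)] assms(2) by (metis atLeastAtMost_iff subsetD)
qed

lemma ring_endo_fixes_tower:
  assumes "ring_endo \<sigma>" "\<And>c. c \<in> K \<Longrightarrow> \<sigma> c = c" "\<And>j. j \<in> {1..i} \<Longrightarrow> \<sigma> (x j) = x j"
    and "z \<in> tower K x i"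
  shows "\<sigma> z = z"
  using assms(3,4)
proof (induction i arbitrary: z)
  case (Suc i)
  show ?case
    by (rule ring_endo_fixes_simple_ext[OF assms(1) Suc.IH]) (use Suc.prems in auto)
qed (use assms(2) in simp)

text \<open>Downward induction from K(x_1, ..., x_n) to K. Each step is
  \<open>invariant_descends\<close>, applied to the pointwise stabilizer of x_1, ..., x_i: fixing
  these generators and K, it fixes all of \<open>tower K x i\<close>.\<close>

theorem invariant_in_base:
  fixes K :: "'b::field set"
  assumes K: "subfield_set K"
    and \<Gamma>: "\<And>\<sigma>. \<sigma> \<in> \<Gamma> \<Longrightarrow> ring_endo \<sigma>" "\<And>\<sigma> c. \<sigma> \<in> \<Gamma> \<Longrightarrow> c \<in> K \<Longrightarrow> \<sigma> c = c"
    and step: "\<And>i. i < n \<Longrightarrow> \<exists>P \<in> polys_over (tower K x i). P \<noteq> 0 \<and> poly P (x (Suc i)) = 0 \<and>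
       Polynomial.degree P \<le> card ((\<lambda>\<sigma>. \<sigma> (x (Suc i))) ` {\<sigma> \<in> \<Gamma>. \<forall>j\<in>{1..i}. \<sigma> (x j) = x j})"
    and f: "f \<in> tower K x n" "\<And>\<sigma>. \<sigma> \<in> \<Gamma> \<Longrightarrow> \<sigma> f = f"
  shows "f \<in> K"
proof -
  have "f \<in> tower K x i" if "i \<le> n" for i
    using that
  proof (induction rule: inc_induct)
    case (step i)
    obtain P where P: "P \<in> polys_over (tower K x i)" "P \<noteq> 0" "poly P (x (Suc i)) = 0"
      "Polynomial.degree P \<le> card ((\<lambda>\<sigma>. \<sigma> (x (Suc i))) ` {\<sigma> \<in> \<Gamma>. \<forall>j\<in>{1..i}. \<sigma> (x j) = x j})"
      using assms(4)[OF step.hyps(2)] by blast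
    show ?case
    proof (rule invariant_descends[OF subfield_set_tower[OF K] P(1-3) _ _ _ P(4)])
      show "f \<in> simple_ext (tower K x i) (x (Suc i))" using step.IH by simp
      show "\<sigma> c = c" if "\<sigma> \<in> {\<sigma> \<in> \<Gamma>. \<forall>j\<in>{1..i}. \<sigma> (x j) = x j}" "c \<in> tower K x i" for \<sigma> c
        by (rule ring_endo_fixes_tower[OF \<Gamma>(1) \<Gamma>(2)]) (use that in auto)
    qed (use \<Gamma>(1) f(2) in auto)
  qed (use f in simp)
  from this[of 0] show ?thesis by simp
qed

section \<open>Frobenius powers and elimination\<close>

lemma frobenius_add:
  fixes x y :: "'b::comm_ring_1"
  assumes "prime CHAR('b)" "q = CHAR('b) ^ e"
  shows "(x + y) ^ (q ^ k) = x ^ (q ^ k) + y ^ (q ^ k)"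
  using freshmans_dream'[OF assms(1), of "q ^ k" "e * k"] by (simp add: assms(2) power_mult)

lemma frobenius_sum:
  fixes f :: "'i \<Rightarrow> 'b::comm_ring_1"
  assumes "prime CHAR('b)" "q = CHAR('b) ^ e"
  shows "sum f A ^ (q ^ k) = (\<Sum>i\<in>A. f i ^ (q ^ k))"
  using freshmans_dream_sum'[OF assms(1), of "q ^ k" "e * k"] by (simp add: assms(2) power_mult)

text \<open>Moore's recursion: if D is a monic additive polynomial killing x_1, ..., x_r, then
  D(t)^Q - D(x_{r+1})^(Q-1) D(t) is again monic and additive, and it kills x_{r+1} as well.\<close>

lemma additive_poly_vanishing:
  fixes x :: "nat \<Rightarrow> 'b::field"
  assumes ch: "prime CHAR('b)" "Q = CHAR('b) ^ e" and L: "subfield_set L"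
    and x: "\<And>j. j \<in> {1..r} \<Longrightarrow> x j \<in> L"
  shows "\<exists>d. (\<forall>a. d a \<in> L) \<and> d r = 1 \<and> (\<forall>j\<in>{1..r}. (\<Sum>a\<le>r. d a * x j ^ (Q ^ a)) = 0)"
  using x
proof (induction r)
  case 0
  then show ?case using subfield_setD(2)[OF L] by (intro exI[of _ "\<lambda>_. 1"]) auto
next
  case (Suc r)
  then obtain d where d: "\<forall>a. d a \<in> L" "d r = 1" "\<forall>j\<in>{1..r}. (\<Sum>a\<le>r. d a * x j ^ (Q ^ a)) = 0"
    by (metis atLeastAtMost_iff le_Suc_eq)
  define D where "D t = (\<Sum>a\<le>r. d a * t ^ (Q ^ a))" for t
  \<comment> \<open>The coefficients of the next polynomial in the recursion: the Q-th power moves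
    \<open>d\<close> up by one index, and the multiple of D is extended by zero to index
    \<open>Suc r\<close>.\<close>
  define d' where "d' a = (if a = 0 then 0 else d (a - 1) ^ Q)
     - D (x (Suc r)) ^ (Q - 1) * (if a \<le> r then d a else 0)" for a
  have Q: "Q > 0" using ch by (simp add: prime_gt_0_nat)
  have "D (x (Suc r)) \<in> L"
    unfolding D_def using d(1) Suc.prems by (intro subfield_set_sum[OF L] subfield_setD[OF L]) auto
  then have "\<forall>a. d' a \<in> L"
    unfolding d'_def using d(1) by (auto intro!: subfield_setD[OF L])
  moreover have "d' (Suc r) = 1" by (simp add: d'_def d(2))
  moreover have D': "(\<Sum>a\<le>Suc r. d' a * t ^ (Q ^ a)) = D t ^ Q - D (x (Suc r)) ^ (Q - 1) * D t" for t
  proof -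
    have "(\<Sum>a\<le>Suc r. (if a = 0 then 0 else d (a - 1) ^ Q) * t ^ (Q ^ a))
        = (\<Sum>a\<le>r. d a ^ Q * t ^ (Q ^ Suc a))"
      by (subst sum.atMost_Suc_shift) simp
    also have "\<dots> = D t ^ Q"
      using frobenius_sum[OF ch, of "\<lambda>a. d a * t ^ (Q ^ a)" "{..r}" 1]
      by (simp add: D_def power_mult_distrib mult.commute flip: power_mult)
    finally have 1: "(\<Sum>a\<le>Suc r. (if a = 0 then 0 else d (a - 1) ^ Q) * t ^ (Q ^ a)) = D t ^ Q" .
    have 2: "(\<Sum>a\<le>Suc r. (if a \<le> r then d a else 0) * t ^ (Q ^ a)) = D t"
      by (simp add: D_def)
    show ?thesis
      unfolding d'_def left_diff_distrib sum_subtractf 1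
      by (simp only: mult.assoc flip: sum_distrib_left) (simp only: 2)
  qed
  moreover have "D t ^ Q - D (x (Suc r)) ^ (Q - 1) * D t = 0" if "t = x (Suc r) \<or> D t = 0" for t
    using that Q power_minus_mult[OF Q, of "D (x (Suc r))"] by (auto simp: power_0_left)
  moreover have "D (x j) = 0" if "j \<in> {1..r}" for j using d(3) that by (simp add: D_def)
  ultimately show ?case by (metis atLeastAtMost_iff le_Suc_eq)
qed

text \<open>The inverse of the last column of a Moore matrix.\<close>

lemma dual_moore_row:
  fixes x :: "nat \<Rightarrow> 'b::field" and C :: "'a::{field,finite} \<Rightarrow> 'b"
  assumes ch: "prime CHAR('b)" "Q = CHAR('b) ^ e" and L: "subfield_set L"
    and x: "\<And>j. j \<in> {1..r} \<Longrightarrow> x j \<in> L" and r: "r \<ge> 1"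
    and Q: "Q = CARD('a)" and C: "\<And>c. C c ^ Q = C c"
    and inj: "inj_on (\<lambda>c. \<Sum>j=1..r. C (c j) * x j) (PiE {1..r} (\<lambda>_. UNIV))"
  shows "\<exists>l. (\<forall>a. l a \<in> L) \<and> (\<forall>i\<in>{1..r}. (\<Sum>a<r. l a * x i ^ (Q ^ a)) = (if i = r then 1 else 0))"
proof -
  obtain s where s: "r = Suc s" using r by (cases r) auto
  \<comment> \<open>With D the additive polynomial killing x_1, ..., x_{r-1}, the wanted row
    consists of the coefficients of D / D(x_r); the point is that D(x_r) is nonzero.\<close>
  obtain d where d: "\<And>a. d a \<in> L" "d s = 1" "\<forall>j\<in>{1..s}. (\<Sum>a\<le>s. d a * x j ^ (Q ^ a)) = 0"
    using additive_poly_vanishing[OF ch L, of s x] x s by auto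
  define D where "D t = (\<Sum>a\<le>s. d a * t ^ (Q ^ a))" for t
  have "card {0, 1 :: 'a} \<le> Q" unfolding Q by (rule card_mono) auto
  then have Q2: "Q \<ge> 2" by simp
  \<comment> \<open>Otherwise D, being additive and commuting with the scalars \<open>C c\<close>,
    vanishes on all Q^r combinations of x_1, ..., x_r, which are distinct by \<open>inj\<close>,
    while its degree is at most Q^(r-1).\<close>
  have "D (x r) \<noteq> 0"
  proof
    assume Dr: "D (x r) = 0"
    then have D0: "D (x j) = 0" if "j \<in> {1..r}" for j
      using d(3) that by (cases "j = r") (auto simp: D_def s)
    have Cpow: "C c ^ (Q ^ a) = C c" for c a
      by (induction a) (simp_all add: C power_mult)
    define P where "P = (\<Sum>a\<le>s. Polynomial.monom (d a) (Q ^ a))"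
    have poly: "poly P t = D t" for t by (simp add: P_def D_def poly_sum poly_monom)
    have deg: "Polynomial.degree P \<le> Q ^ s"
      unfolding P_def using Q2
      by (intro degree_sum_le) (auto intro!: order.trans[OF degree_monom_le] power_increasing)
    have "Polynomial.coeff P (Q ^ s) = (\<Sum>a\<le>s. if a = s then d a else 0)"
      unfolding P_def coeff_sum coeff_monom using Q2 by (intro sum.cong) auto
    then have P0: "P \<noteq> 0" using d(2) by auto
    let ?I = "PiE {1..r} (\<lambda>_. UNIV :: 'a set)" and ?f = "\<lambda>c. \<Sum>j=1..r. C (c j) * x j"
    have "?f ` ?I \<subseteq> {t. poly P t = 0}"
    proof clarify
      fix c
      have "D (?f c) = (\<Sum>a\<le>s. \<Sum>j=1..r. C (c j) * (d a * x j ^ (Q ^ a)))"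
        by (simp add: D_def frobenius_sum[OF ch] power_mult_distrib Cpow sum_distrib_left algebra_simps)
      also have "\<dots> = (\<Sum>j=1..r. C (c j) * D (x j))"
        by (subst sum.swap) (simp add: D_def sum_distrib_left)
      finally show "poly P (?f c) = 0" by (simp add: poly D0)
    qed
    then have "card (?f ` ?I) \<le> card {t. poly P t = 0}"
      by (intro card_mono poly_roots_finite P0)
    also have "\<dots> \<le> Q ^ s" using card_poly_roots_bound[OF P0] deg by linarith
    finally have "card ?I \<le> Q ^ s" unfolding card_image[OF inj] .
    then have "Q ^ r \<le> Q ^ s" by (simp add: card_PiE Q)
    then show False using Q2 s by simp
  qed
  define l where "l a = d a / D (x r)" for a
  have "D (x r) \<in> L"
    unfolding D_def using d(1) x r by (intro subfield_set_sum[OF L] subfield_setD[OF L]) auto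
  then have "\<forall>a. l a \<in> L" using d(1) by (auto simp: l_def intro: subfield_setD[OF L])
  moreover have "(\<Sum>a<r. l a * t ^ (Q ^ a)) = D t / D (x r)" for t
    unfolding D_def s lessThan_Suc_atMost by (simp add: l_def s sum_divide_distrib D_def)
  ultimately show ?thesis
    using d(3) \<open>D (x r) \<noteq> 0\<close> by (intro exI[of _ l]) (auto simp: D_def s le_Suc_eq)
qed

text \<open>Writing \<open>c a b\<close> for the pairing of the Frobenius twists of \<open>(x, y)\<close> by \<open>q\<^bsup>2a\<^esup>\<close> and
  \<open>q\<^bsup>2b+1\<^esup>\<close>, the sum of \<open>l a * l b ^ q * c a b\<close> involves only \<open>y r\<close>, because \<open>l\<close> and
  \<open>l ^ q\<close> are dual to the twists of \<open>x\<close>.\<close>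

lemma unitary_elimination:
  fixes x y l :: "nat \<Rightarrow> 'b::field"
  assumes ch: "prime CHAR('b)" "q = CHAR('b) ^ e" and q: "q \<ge> 2" and L: "subfield_set L"
    and r: "r \<ge> 1" and l: "\<And>a. l a \<in> L"
    and dual: "\<And>i. i \<in> {1..r} \<Longrightarrow> (\<Sum>a<r. l a * x i ^ (q ^ (2*a))) = (if i = r then 1 else 0)"
    and h: "\<And>k. k \<in> {1..r} \<Longrightarrow>
      (\<Sum>i=1..r. x i * y i ^ (q ^ (2*k - 1)) + x i ^ (q ^ (2*k - 1)) * y i) \<in> L"
  shows "\<exists>P \<in> polys_over L. P \<noteq> 0 \<and> poly P (y r) = 0 \<and> Polynomial.degree P \<le> q ^ (2*r - 1)"
proof -
  define c where "c a b = (\<Sum>i=1..r. x i ^ (q ^ (2*a)) * y i ^ (q ^ (2*b+1))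
    + x i ^ (q ^ (2*b+1)) * y i ^ (q ^ (2*a)))" for a b
  \<comment> \<open>Frobenius is additive, so raising a pairing to the power q^u raises both of its
    exponents of q by u.\<close>
  have pair: "(\<Sum>i=1..r. x i ^ (q ^ u) * y i ^ (q ^ (w + u)) + x i ^ (q ^ (w + u)) * y i ^ (q ^ u))
      = (\<Sum>i=1..r. x i * y i ^ (q ^ w) + x i ^ (q ^ w) * y i) ^ (q ^ u)" for u w
    by (simp only: frobenius_sum[OF ch] frobenius_add[OF ch] power_mult_distrib power_add power_mult)
  \<comment> \<open>For a \<le> b, \<open>c a b\<close> is the q^(2a)-th power of the expression in
    \<open>h\<close> with k = b - a + 1. For a > b it is the q^(2b+1)-th power of the one with k = a
    - b, the two summands trading places.\<close>
  have c_L: "c a b \<in> L" if "a < r" "b < r" for a b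
  proof (cases "a \<le> b")
    case True
    then have "2*b+1 = (2 * (b-a+1) - 1) + 2*a" by simp
    then have "c a b = (\<Sum>i=1..r. x i * y i ^ (q ^ (2*(b-a+1) - 1))
        + x i ^ (q ^ (2*(b-a+1) - 1)) * y i) ^ (q ^ (2*a))"
      unfolding c_def by (simp only: pair)
    then show ?thesis using h[of "b-a+1"] that True by (auto intro: subfield_setD(9)[OF L])
  next
    case False
    then have "2*a = (2 * (a-b) - 1) + (2*b+1)" by simp
    then have "c a b = (\<Sum>i=1..r. x i * y i ^ (q ^ (2*(a-b) - 1))
        + x i ^ (q ^ (2*(a-b) - 1)) * y i) ^ (q ^ (2*b+1))"
      unfolding c_def by (subst add.commute) (simp only: pair)
    moreover have "a - b \<in> {1..r}" using that False by auto
    ultimately show ?thesis using subfield_setD(9)[OF L h] by simp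
  qed
  have dual': "(\<Sum>a<r. l a ^ q * x i ^ (q ^ (2*a+1))) = (if i = r then 1 else 0)"
    if "i \<in> {1..r}" for i
  proof -
    have "(\<Sum>a<r. l a ^ q * x i ^ (q ^ (2*a+1))) = (\<Sum>a<r. l a * x i ^ (q ^ (2*a))) ^ (q ^ 1)"
      unfolding frobenius_sum[OF ch] by (simp add: power_mult_distrib mult.commute flip: power_mult)
    then show ?thesis using q by (simp add: dual[OF that])
  qed
  define \<kappa> where "\<kappa> = (\<Sum>a<r. \<Sum>b<r. l a * l b ^ q * c a b)"
  have \<kappa>_L: "\<kappa> \<in> L" unfolding \<kappa>_def
    by (intro subfield_set_sum[OF L] subfield_setD[OF L] l c_L) auto
  have "\<kappa> = (\<Sum>i=1..r. (\<Sum>a<r. l a * x i ^ (q ^ (2*a))) * (\<Sum>b<r. l b ^ q * y i ^ (q ^ (2*b+1)))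
      + (\<Sum>a<r. l a * y i ^ (q ^ (2*a))) * (\<Sum>b<r. l b ^ q * x i ^ (q ^ (2*b+1))))"
  proof -
    have "\<kappa> = (\<Sum>a<r. \<Sum>i=1..r. \<Sum>b<r. l a * x i ^ (q ^ (2*a)) * (l b ^ q * y i ^ (q ^ (2*b+1)))
       + l a * y i ^ (q ^ (2*a)) * (l b ^ q * x i ^ (q ^ (2*b+1))))"
      unfolding \<kappa>_def c_def sum_distrib_left
      by (rule sum.cong[OF refl], subst sum.swap) (simp add: algebra_simps)
    also have "\<dots> = (\<Sum>i=1..r. \<Sum>a<r. \<Sum>b<r. l a * x i ^ (q ^ (2*a)) * (l b ^ q * y i ^ (q ^ (2*b+1)))
       + l a * y i ^ (q ^ (2*a)) * (l b ^ q * x i ^ (q ^ (2*b+1))))"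
      by (rule sum.swap)
    finally show ?thesis by (simp only: sum_product sum.distrib)
  qed
  also have "\<dots> = (\<Sum>i=1..r. if i = r then (\<Sum>b<r. l b ^ q * y i ^ (q ^ (2*b+1)))
      + (\<Sum>a<r. l a * y i ^ (q ^ (2*a))) else 0)"
    by (intro sum.cong refl) (simp only: dual dual' split: if_split, simp)
  also have "\<dots> = (\<Sum>b<r. l b ^ q * y r ^ (q ^ (2*b+1))) + (\<Sum>a<r. l a * y r ^ (q ^ (2*a)))"
    using r by simp
  finally have \<kappa>: "\<kappa> = \<dots>" .
  \<comment> \<open>The exponents 2a and 2a+1 with a < r run over 0, ..., 2r-1, whence the degree
    bound q^(2r-1).\<close>
  define P where "P = (\<Sum>a<r. Polynomial.monom (l a) (q ^ (2*a)) + Polynomial.monom (l a ^ q) (q ^ (2*a+1))) - [:\<kappa>:]"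
  have "poly P (y r) = 0"
    by (simp add: P_def poly_sum poly_monom \<kappa> sum.distrib)
  moreover have "P \<in> polys_over L" unfolding P_def
    by (intro polys_over_closed[OF L] polys_over_sum[OF L] l \<kappa>_L subfield_setD(9)[OF L])
  moreover have "Polynomial.degree P \<le> q ^ (2*r - 1)"
  proof -
    have "q ^ (2*a) \<le> q ^ (2*r - 1) \<and> q ^ (2*a+1) \<le> q ^ (2*r - 1)" if "a < r" for a
      by (intro conjI power_increasing) (use q that in auto)
    then show ?thesis unfolding P_def
      by (intro degree_diff_le degree_sum_le degree_add_le order.trans[OF degree_monom_le]) simp_all
  qed
  moreover have "P \<noteq> 0"
  proof
    assume P0: "P = 0"
    \<comment> \<open>Odd powers of q occur as degrees only with the coefficients
      \<open>l a ^ q\<close>, and \<kappa> sits in degree 0. So P = 0 would make every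
      \<open>l a\<close> vanish, against \<open>dual\<close> at i = r.\<close>
    have "l a = 0" if a: "a < r" for a
    proof -
      have "Polynomial.coeff P (q ^ (2*a+1)) = (\<Sum>b<r. if b = a then l b ^ q else 0)"
      proof -
        have "q ^ (2*b) = q ^ (2*a+1) \<longleftrightarrow> False" for b
          using q by (subst power_inject_exp) (auto, presburger)
        moreover have "q ^ (2*b+1) = q ^ (2*a+1) \<longleftrightarrow> b = a" for b
          using q by (subst power_inject_exp) auto
        moreover have "Polynomial.coeff [:\<kappa>:] (q ^ (2*a+1)) = 0"
          using q by (subst coeff_pCons) (auto split: nat.split)
        ultimately show ?thesis
          unfolding P_def coeff_diff coeff_sum coeff_add coeff_monom by (simp only: if_False) simp
      qed
      then show ?thesis using P0 a q by simp
    qed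
    then show False using dual[of r] r by simp
  qed
  ultimately show ?thesis by blast
qed

section \<open>Unitary root elements and the field of rational functions\<close>

lemma power_card_eq_same: "(a :: 'a::{field,finite}) ^ CARD('a) = a"
proof (cases "a = 0")
  case False
  let ?U = "UNIV - {0 :: 'a}"
  have "bij_betw ((*) a) ?U ?U"
    by (rule bij_betw_byWitness[of _ "\<lambda>x. x / a"]) (use False in auto)
  then have "(\<Prod>x\<in>?U. a * x) = \<Prod>?U"
    by (rule prod.reindex_bij_betw)
  then have "a ^ card ?U = 1" by (simp add: prod.distrib)
  moreover have "card (UNIV :: 'a set) = Suc (card ?U)" by (rule card.remove) simp_all
  ultimately show ?thesis by (metis power_Suc mult_1_right)
qed (simp add: power_0_left)

text \<open>The map b -> b - b^q sends the field into the elements of trace zero. Its fibres are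
  root sets of polynomials of degree q, so its image has at least q^2 / q elements.\<close>

lemma card_trace_zero:
  assumes "prime p" "q = p ^ e" "CARD('a::{field,finite}) = q\<^sup>2" "q \<ge> 2"
  shows "q \<le> card {a :: 'a. a + a ^ q = 0}"
proof -
  have ch: "prime CHAR('a)" "q = CHAR('a) ^ e"
    using CHAR_finite_field[where 'a = 'a, of p e] assms by simp_all
  let ?T = "{a :: 'a. a + a ^ q = 0}"
  have qq: "(a ^ q) ^ q = a" for a :: 'a
    using power_card_eq_same[of a] assms(3) by (simp add: power2_eq_square flip: power_mult)
  have fib: "card {b. b - b ^ q = c} \<le> q" for c :: 'a
  proof -
    define P where "P = Polynomial.monom 1 1 - Polynomial.monom 1 q - [:c:]"
    have "Polynomial.coeff P q = - 1"
      using assms(4) by (simp add: P_def coeff_pCons split: nat.split)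
    then have "P \<noteq> 0" by auto
    moreover have "Polynomial.degree P \<le> q"
      unfolding P_def using assms(4)
      by (intro degree_diff_le) (auto intro!: order.trans[OF degree_monom_le])
    moreover have "{b. b - b ^ q = c} = {b. poly P b = 0}"
      by (auto simp: P_def poly_monom)
    ultimately show ?thesis using card_poly_roots_bound[of P] by simp
  qed
  have "(b - b ^ q) ^ q = b ^ q - (b ^ q) ^ q" for b :: 'a
    using frobenius_add[OF ch, of "b - b ^ q" "b ^ q" 1] by (simp add: algebra_simps)
  then have "b - b ^ q \<in> ?T" for b by (simp add: qq)
  then have "UNIV = (\<Union>c\<in>?T. {b. b - b ^ q = c})" by blast
  then have "CARD('a) = card (\<Union>c\<in>?T. {b. b - b ^ q = c})" by (rule arg_cong)
  also have "\<dots> \<le> (\<Sum>c\<in>?T. card {b. b - b ^ q = c})" by (rule card_UN_le) simp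
  also have "\<dots> \<le> card ?T * q" using sum_bounded_above[of ?T, OF fib] by simp
  finally show ?thesis using assms(3,4) by (simp add: power2_eq_square)
qed

text \<open>Left multiplication by \<open>antidiag n\<close> reverses the rows, so the matrix
  equation pairs column j with the reversed q-th power of column l.\<close>

lemma unitary_iff:
  fixes A :: "'a::field mat"
  assumes A: "A \<in> carrier_mat n n"
  shows "transpose_mat A * antidiag n * bar q A = antidiag n \<longleftrightarrow>
    (\<forall>j<n. \<forall>l<n. (\<Sum>r<n. A $$ (r, j) * A $$ (n - 1 - r, l) ^ q) = (if j + l + 1 = n then 1 else 0))"
proof -
  let ?J = "antidiag n :: 'a mat"
  have J: "?J \<in> carrier_mat n n" by (simp add: antidiag_def)
  have "(?J * bar q A) $$ (r, l) = A $$ (n - 1 - r, l) ^ q" if "r < n" "l < n" for r l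
  proof -
    have "(?J * bar q A) $$ (r, l) = (\<Sum>k<n. (if r + k + 1 = n then 1 else 0) * A $$ (k, l) ^ q)"
      using that A by (simp add: antidiag_def bar_def scalar_prod_def atLeast0LessThan)
    also have "\<dots> = (\<Sum>k<n. if k = n - 1 - r then A $$ (k, l) ^ q else 0)"
      using that by (intro sum.cong) auto
    also have "\<dots> = A $$ (n - 1 - r, l) ^ q" using that by simp
    finally show ?thesis .
  qed
  moreover have "transpose_mat A * ?J * bar q A = transpose_mat A * (?J * bar q A)"
    using A J by (intro assoc_mult_mat[of _ n n _ n _ n]) (auto simp: bar_def)
  ultimately have "(transpose_mat A * ?J * bar q A) $$ (j, l) = (\<Sum>r<n. A $$ (r, j) * A $$ (n - 1 - r, l) ^ q)"
    if "j < n" "l < n" for j l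
    using that A J by (simp add: scalar_prod_def atLeast0LessThan bar_def)
  moreover have "?J $$ (j, l) = (if j + l + 1 = n then 1 else 0)" if "j < n" "l < n" for j l
    using that by (simp add: antidiag_def)
  moreover have "transpose_mat A * ?J * bar q A \<in> carrier_mat n n"
    using A J by (auto simp: bar_def)
  ultimately show ?thesis
    using J unfolding mat_eq_iff carrier_mat_def by (simp del: index_mult_mat)
qed

text \<open>The identity with \<open>a\<close> added to row \<open>i\<close> (indexed from 0), and column \<open>n - 1 - i\<close>
  corrected so that the matrix becomes unitary.\<close>

definition root_mat :: "nat \<Rightarrow> nat \<Rightarrow> nat \<Rightarrow> (nat \<Rightarrow> 'a::field) \<Rightarrow> 'a mat" where
  "root_mat q n i a = mat n n (\<lambda>(r, c). (if r = c then 1 else 0) + (if r = i then a c else 0)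
     - (if c = n - 1 - i \<and> r \<noteq> i then a (n - 1 - r) ^ q else 0))"

text \<open>The support condition places all new entries strictly below the diagonal. The new row
  and the corrected column cross at entry (i, n-1-i), where the entry must be its own correction;
  this is the trace condition.\<close>

lemma root_mat_in_sylow_GU:
  fixes a :: "nat \<Rightarrow> 'a::{field,finite}"
  assumes pq: "prime p" "q = p ^ e" "CARD('a) = q\<^sup>2" "q \<ge> 2"
    and i: "i < 2 * m" and supp: "\<And>c. a c \<noteq> 0 \<Longrightarrow> c < i \<and> c + i \<le> 2 * m - 1"
    and tr: "a (2 * m - 1 - i) + a (2 * m - 1 - i) ^ q = 0"
  shows "root_mat q (2 * m) i a \<in> carrier (sylow_GU q (2 * m))"
proof -
  define n where "n = 2 * m"
  have nz: "a c = 0" if "\<not> (c < i \<and> c + i \<le> n - 1)" for c using supp that unfolding n_def by blast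
  have q0: "(0::'a) ^ q = 0" using pq(4) by (simp add: power_0_left)
  have ch: "prime CHAR('a)" "q = CHAR('a) ^ e"
    using CHAR_finite_field[where 'a = 'a, of p e] pq by simp_all
  have qq: "(b ^ q) ^ q = b" for b :: 'a
    using power_card_eq_same[of b] pq(3) by (simp add: power2_eq_square flip: power_mult)
  have pow_diff: "(b + c - d) ^ q = b ^ q + c ^ q - d ^ q" for b c d :: 'a
    using frobenius_add[OF ch, of "b + c - d" d 1] frobenius_add[OF ch, of b c 1]
    by (simp add: algebra_simps)
  let ?A = "root_mat q n i a"
  have A: "?A \<in> carrier_mat n n" by (simp add: root_mat_def)
  have "?A \<in> lower_unitriangular n"
    using A nz q0 i by (auto simp: lower_unitriangular_def root_mat_def n_def)
  moreover have "(\<Sum>r<n. ?A $$ (r, j) * ?A $$ (n - 1 - r, l) ^ q) = (if j + l + 1 = n then 1 else 0)"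
    if jl: "j < n" "l < n" for j l
  proof -
    let ?i = "n - 1 - i"
    \<comment> \<open>\<open>u\<close> is the column correction, and \<open>v\<close> is the same
      correction after reversing the rows and taking q-th powers, which \<open>qq\<close>
      simplifies.\<close>
    define u where "u r = (if r \<noteq> i then a (n - 1 - r) ^ q else 0)" for r
    define v where "v r = (if r \<noteq> ?i then a r else 0)" for r
    have 1: "?A $$ (r, j) = (if r = j then 1 else 0) + (if r = i then a j else 0)
        - (if j = ?i then u r else 0)" if "r < n" for r
      using that jl by (simp add: root_mat_def u_def)
    have 2: "?A $$ (n - 1 - r, l) ^ q = (if r = n - 1 - l then 1 else 0)
        + (if r = ?i then a l ^ q else 0) - (if l = ?i then v r else 0)" if "r < n" for r
    proof -
      have "n - 1 - r = i \<longleftrightarrow> r = ?i" "n - 1 - r = l \<longleftrightarrow> r = n - 1 - l" "n - 1 - (n - 1 - r) = r"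
        "n - 1 - ?i = i" "n - 1 - (n - 1 - l) = l"
        using that jl i by (auto simp: n_def)
      then show ?thesis
        using that jl by (simp add: root_mat_def v_def pow_diff q0 qq if_distrib[of "\<lambda>z. z ^ q"])
    qed
    \<comment> \<open>A nonzero product needs \<open>a\<close> nonzero at both r and n-1-r, hence r
      + i \<le> n - 1 and n - 1 - r < i at once, a contradiction.\<close>
    have uv: "u r * v r = 0" if "r < n" for r
    proof -
      have "a (n - 1 - r) = 0 \<or> a r = 0"
      proof (rule ccontr)
        assume "\<not> ?thesis"
        then have "r < i \<and> r + i \<le> n - 1" "n - 1 - r < i \<and> n - 1 - r + i \<le> n - 1"
          using nz by blast+
        then show False using that by linarith
      qed
      then show ?thesis unfolding u_def v_def by (elim disjE) (simp_all add: q0 del: mult_eq_0_iff)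
    qed
    have vi: "v i = 0" and ui: "u ?i = 0"
      using nz[of i] i by (auto simp: v_def u_def q0 n_def)
    have ii: "i \<noteq> ?i" using i by (simp add: n_def) presburger
    have "(\<Sum>r<n. ?A $$ (r, j) * ?A $$ (n - 1 - r, l) ^ q) =
      (\<Sum>r<n. (if r = j then (if j = n - 1 - l then 1 else 0) + (if j = ?i then a l ^ q else 0)
          - (if l = ?i then v j else 0) else 0)
        + (if r = i then (if i = n - 1 - l then a j else 0) else 0)
        - (if r = n - 1 - l then (if j = ?i then u (n - 1 - l) else 0) else 0))"
    proof (intro sum.cong refl)
      fix r assume "r \<in> {..<n}"
      then have r: "r < n" by simp
      show "?A $$ (r, j) * ?A $$ (n - 1 - r, l) ^ q = (if r = j then (if j = n - 1 - l then 1 else 0) + (if j = ?i then a l ^ q else 0)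
          - (if l = ?i then v j else 0) else 0)
        + (if r = i then (if i = n - 1 - l then a j else 0) else 0)
        - (if r = n - 1 - l then (if j = ?i then u (n - 1 - l) else 0) else 0)"
      proof -
        let ?x = "if r = j then 1 else 0 :: 'a" and ?x' = "if r = n - 1 - l then 1 else 0 :: 'a"
        let ?y = "if r = i then a j else 0" and ?y' = "if r = ?i then a l ^ q else 0"
        let ?z = "if j = ?i then u r else 0" and ?z' = "if l = ?i then v r else 0"
        \<comment> \<open>The last bracket collects the four products of two modifications of the
          identity; they vanish by \<open>ii\<close>, \<open>vi\<close>, \<open>ui\<close> and
          \<open>uv\<close> in turn.\<close>
        have "(?x + ?y - ?z) * (?x' + ?y' - ?z')
            = ?x * (?x' + ?y' - ?z') + ?y * ?x' - ?z * ?x' + (?y * ?y' - ?y * ?z' - ?z * ?y' + ?z * ?z')"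
          by (simp only: algebra_simps)
        also have "?y * ?y' = 0" using ii by simp
        also have "?y * ?z' = 0" using vi by simp
        also have "?z * ?y' = 0" using ui by simp
        also have "?z * ?z' = 0" using uv[OF r] by simp
        also have "?x * (?x' + ?y' - ?z') = (if r = j then (if j = n - 1 - l then 1 else 0)
            + (if j = ?i then a l ^ q else 0) - (if l = ?i then v j else 0) else 0)"
          by (cases "r = j") simp_all
        also have "?y * ?x' = (if r = i then (if i = n - 1 - l then a j else 0) else 0)"
          by (cases "r = i") simp_all
        also have "?z * ?x' = (if r = n - 1 - l then (if j = ?i then u (n - 1 - l) else 0) else 0)"
          by (cases "r = n - 1 - l") simp_all
        finally show ?thesis unfolding 1[OF r] 2[OF r] by simp
      qed
    qed
    also have "\<dots> = (if j = n - 1 - l then 1 else 0) + (if j = ?i then a l ^ q else 0)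
          - (if l = ?i then v j else 0) + (if i = n - 1 - l then a j else 0)
          - (if j = ?i then u (n - 1 - l) else 0)"
      using jl i by (simp add: sum.distrib sum_subtractf n_def)
    \<comment> \<open>The remaining terms cancel in pairs, except at j = l = n-1-i, where the trace
      condition is what cancels them.\<close>
    also have "\<dots> = (if j = n - 1 - l then 1 else 0)"
    proof -
      have "n - 1 - l = i \<longleftrightarrow> l = ?i" "i = n - 1 - l \<longleftrightarrow> l = ?i" "n - 1 - (n - 1 - l) = l"
        using jl i by (auto simp: n_def)
      moreover have "a ?i ^ q + a ?i = 0" using tr by (simp add: n_def add.commute)
      ultimately show ?thesis unfolding u_def v_def
        by (cases "j = ?i"; cases "l = ?i") (simp_all only: if_True if_False not_True_eq_False
            not_False_eq_True add_0_right diff_0_right diff_self add_diff_cancel_right' diff_add_cancel add.assoc)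
    qed
    also have "\<dots> = (if j + l + 1 = n then 1 else 0)" using jl by auto
    finally show ?thesis .
  qed
  ultimately show ?thesis
    using unitary_iff[OF A] by (simp add: sylow_GU_def flip: n_def)
qed

section \<open>Rational functions: constants, coordinates and the group action\<close>

lemma poly_fract_simps:
  "poly_fract 0 = 0" "poly_fract 1 = 1" "poly_fract (f + g) = poly_fract f + poly_fract g"
  "poly_fract (f * g) = poly_fract f * poly_fract g" "poly_fract (f - g) = poly_fract f - poly_fract g"
  "poly_fract f = poly_fract g \<longleftrightarrow> f = g"
  by (simp_all add: poly_fract_def Zero_fract_def One_fract_def eq_fract)

lemma poly_fract_power: "poly_fract (f ^ k) = poly_fract f ^ k"
  by (induction k) (simp_all add: poly_fract_simps)

lemma poly_fract_sum: "poly_fract (sum f I) = (\<Sum>i\<in>I. poly_fract (f i))"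
  by (induction I rule: infinite_finite_induct) (simp_all add: poly_fract_simps)

lemma poly_fract_prod: "poly_fract (prod f I) = (\<Prod>i\<in>I. poly_fract (f i))"
  by (induction I rule: infinite_finite_induct) (simp_all add: poly_fract_simps)

lemma Fract_eq_divide: "b \<noteq> 0 \<Longrightarrow> Fract a b = poly_fract a / poly_fract b"
  by (simp add: poly_fract_def divide_fract)

definition coord :: "nat \<Rightarrow> 'a::field mpoly fract" where
  "coord i = poly_fract (Var i)"

definition cst :: "'a \<Rightarrow> 'a::field mpoly fract" where
  "cst c = poly_fract (Const c)"

lemma cst_simps: "cst 0 = 0" "cst 1 = 1" "cst (a + b) = cst a + cst b" "cst (a * b) = cst a * cst b"
  by (simp_all add: cst_def Const_simps poly_fract_simps)

lemma cst_sum: "cst (sum f I) = (\<Sum>i\<in>I. cst (f i))"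
  by (induction I rule: infinite_finite_induct) (simp_all add: cst_simps)

lemma cst_power: "cst (a ^ k) = cst a ^ k"
  by (induction k) (simp_all add: cst_simps)

text \<open>The coefficients are recovered at the monomials of degree one. This supplies
  \<open>inj\<close> in \<open>dual_moore_row\<close> and later counts conjugates; extensionality
  makes the coefficient family unique.\<close>

lemma linear_form_inject:
  "inj_on (\<lambda>c. \<Sum>j=1..r. cst (c j) * coord j) (PiE {1..r} (\<lambda>_. UNIV :: 'a::field set))"
proof (rule inj_onI)
  fix c d :: "nat \<Rightarrow> 'a"
  assume cd: "c \<in> PiE {1..r} (\<lambda>_. UNIV)" "d \<in> PiE {1..r} (\<lambda>_. UNIV)"
  assume eq: "(\<Sum>j=1..r. cst (c j) * coord j) = (\<Sum>j=1..r. cst (d j) * coord j)"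
  have "poly_fract (\<Sum>j=1..r. Const (c j) * Var j) = poly_fract (\<Sum>j=1..r. Const (d j) * Var j)"
    using eq by (simp only: cst_def coord_def poly_fract_sum poly_fract_simps)
  then have eq': "(\<Sum>j=1..r. Const (c j) * Var j) = (\<Sum>j=1..r. Const (d j) * Var j)"
    by (simp only: poly_fract_simps)
  have lk: "Poly_Mapping.lookup (\<Sum>j=1..r. Const (f j) * Var j) (Poly_Mapping.single k 1) = f k"
    if "k \<in> {1..r}" for f :: "nat \<Rightarrow> 'a" and k
  proof -
    have "Poly_Mapping.lookup (\<Sum>j=1..r. Const (f j) * Var j) (Poly_Mapping.single k 1)
        = (\<Sum>j=1..r. if j = k then f j else 0)"
      unfolding lookup_sum
    proof (intro sum.cong refl)
      fix j
      have "Poly_Mapping.single j (1::nat) = Poly_Mapping.single k 1 \<longleftrightarrow> j = k"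
        by (metis lookup_single_eq lookup_single_not_eq zero_neq_one)
      then show "Poly_Mapping.lookup (Const (f j) * Var j) (Poly_Mapping.single k 1) = (if j = k then f j else 0)"
        by (simp add: Const_def Var_def mult_single lookup_single when_def)
    qed
    then show ?thesis using that by simp
  qed
  show "c = d"
  proof (rule PiE_ext[OF cd])
    fix k assume "k \<in> {1..r}"
    then show "c k = d k" using lk[of k c] lk[of k d] eq' by simp
  qed
qed

lemma act_fract_poly_fract:
  "g \<in> carrier (GL n) \<Longrightarrow> act_fract n g (poly_fract f) = poly_fract (act_poly n g f)"
  unfolding poly_fract_def
  by (subst act_fract_Fract) (simp_all add: act_poly_def subst_poly_1)

lemma ring_endo_act_fract:
  assumes g: "g \<in> carrier (GL n)"
  shows "ring_endo (act_fract n g)"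
proof -
  note simps = act_fract_Fract[OF g] act_poly_eq_0_iff[OF g]
  have act: "act_poly n g (a + b) = act_poly n g a + act_poly n g b"
    "act_poly n g (a * b) = act_poly n g a * act_poly n g b" for a b
    by (simp_all add: act_poly_def subst_poly_add subst_poly_mult)
  have "act_fract n g (x + y) = act_fract n g x + act_fract n g y \<and>
    act_fract n g (x * y) = act_fract n g x * act_fract n g y" for x y
  proof -
    obtain a b where x: "x = Fract a b" "b \<noteq> 0" by (cases x)
    obtain c d where y: "y = Fract c d" "d \<noteq> 0" by (cases y)
    show ?thesis using x y by (simp add: simps act)
  qed
  moreover have "act_fract n g 1 = 1"
    using act_fract_poly_fract[OF g, of 1]
    by (simp add: poly_fract_simps act_poly_def subst_poly_1)
  ultimately show ?thesis by (simp add: ring_endo_def)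
qed

lemma act_fract_cst: "g \<in> carrier (GL n) \<Longrightarrow> act_fract n g (cst c) = cst c"
  by (simp add: cst_def act_fract_poly_fract act_poly_def subst_poly_Const)

lemma act_fract_coord:
  assumes "g \<in> carrier (GL n)" "i \<in> {1..n}"
  shows "act_fract n g (coord i) = (\<Sum>j=1..n. cst ((inv\<^bsub>GL n\<^esub> g) $$ (i - 1, j - 1)) * coord j)"
  using assms
  by (simp add: coord_def act_fract_poly_fract act_poly_def subst_poly_Var lin_subst_def
      poly_fract_sum poly_fract_simps cst_def)

section \<open>From fields given as records to subsets of the type of fractions\<close>

lemma in_function_field_iff:
  "x \<in> carrier (function_field n) \<longleftrightarrow> (\<exists>a b. x = Fract a b \<and> a \<in> polys_in n \<and> b \<in> polys_in n \<and> b \<noteq> 0)"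
  by (auto simp: function_field_def)

lemma polys_in_0_1: "0 \<in> polys_in n" "(1 :: 'a::field mpoly) \<in> polys_in n"
  using polys_in_Const[of "1::'a" n] by (simp_all add: polys_in_def Const_simps)

lemma polys_in_Var: "i \<in> {1..n} \<Longrightarrow> (Var i :: 'a::field mpoly) \<in> polys_in n"
  by (simp add: polys_in_def Var_def)

lemma polys_in_sum: "(\<And>i. i \<in> I \<Longrightarrow> f i \<in> polys_in n) \<Longrightarrow> (sum f I :: 'a::field mpoly) \<in> polys_in n"
  by (induction I rule: infinite_finite_induct) (auto simp: polys_in_0_1 polys_in_add)

lemma polys_in_prod: "(\<And>i. i \<in> I \<Longrightarrow> f i \<in> polys_in n) \<Longrightarrow> (prod f I :: 'a::field mpoly) \<in> polys_in n"
  by (induction I rule: infinite_finite_induct) (auto simp: polys_in_0_1 polys_in_mult)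

lemma polys_in_power: "f \<in> polys_in n \<Longrightarrow> (f ^ k :: 'a::field mpoly) \<in> polys_in n"
  by (induction k) (auto simp: polys_in_0_1 polys_in_mult)

lemma poly_fract_in_function_field:
  "f \<in> polys_in n \<Longrightarrow> poly_fract f \<in> carrier (function_field n)" for f :: "'a::field mpoly"
  unfolding in_function_field_iff poly_fract_def using polys_in_0_1(2)[of n]
  by (intro exI[of _ f] exI[of _ 1]) simp

text \<open>Negation and inverse in a record are determined relative to its carrier, hence the
  membership premises for these two.\<close>

lemma function_field_ops:
  fixes x y :: "'a::field mpoly fract"
  shows "\<one>\<^bsub>function_field n\<^esub> = (1 :: 'a mpoly fract)"
  "\<zero>\<^bsub>function_field n\<^esub> = (0 :: 'a mpoly fract)"
  "x \<oplus>\<^bsub>function_field n\<^esub> y = x + y" "x \<otimes>\<^bsub>function_field n\<^esub> y = x * y"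
  "x \<in> carrier (function_field n) \<Longrightarrow> \<ominus>\<^bsub>function_field n\<^esub> x = - x"
  "x \<in> carrier (function_field n) \<Longrightarrow> x \<noteq> 0 \<Longrightarrow> inv\<^bsub>function_field n\<^esub> x = inverse x"
proof -
  interpret R: field "function_field n :: 'a mpoly fract ring" by (rule field_function_field)
  show ops: "\<one>\<^bsub>function_field n\<^esub> = (1 :: 'a mpoly fract)"
    "\<zero>\<^bsub>function_field n\<^esub> = (0 :: 'a mpoly fract)"
    "x \<oplus>\<^bsub>function_field n\<^esub> y = x + y" "x \<otimes>\<^bsub>function_field n\<^esub> y = x * y" for x y :: "'a mpoly fract"
    by (simp_all add: function_field_def ring_of_type_algebra_def)
  show "\<ominus>\<^bsub>function_field n\<^esub> x = - x" if "x \<in> carrier (function_field n)"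
    using R.r_neg[OF that] by (simp add: ops eq_neg_iff_add_eq_0 add.commute)
  show "inv\<^bsub>function_field n\<^esub> x = inverse x" if "x \<in> carrier (function_field n)" "x \<noteq> 0"
  proof -
    have "x \<in> Units (function_field n)" using that by (simp add: R.field_Units ops)
    from R.Units_r_inv[OF this] show ?thesis by (simp add: ops inverse_unique)
  qed
qed

lemma adjoin_fractions_incl:
  "cst c \<in> adjoin_fractions n S" "x \<in> S \<Longrightarrow> x \<in> adjoin_fractions n S"
  unfolding adjoin_fractions_def cst_def by (auto intro: generate_field.incl)

context
  fixes n :: nat and S :: "'a::field mpoly fract set"
  assumes S: "S \<subseteq> carrier (function_field n)"
begin

lemma generators_in_function_field:
  "range (\<lambda>c. poly_fract (Const c)) \<union> S \<subseteq> carrier (function_field n)"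
  using S poly_fract_in_function_field[OF polys_in_Const] by blast

lemma adjoin_fractions_subset: "adjoin_fractions n S \<subseteq> carrier (function_field n)"
  unfolding adjoin_fractions_def
  by (rule field.generate_field_incl[OF field_function_field generators_in_function_field])

lemma subfield_set_adjoin_fractions: "subfield_set (adjoin_fractions n S)"
proof -
  let ?K = "adjoin_fractions n S" and ?R = "function_field n :: 'a mpoly fract ring"
  have 0: "0 \<in> ?K" "1 \<in> ?K" using adjoin_fractions_incl(1)[of 0] adjoin_fractions_incl(1)[of 1]
    by (simp_all only: cst_simps)
  define H where "H = range (\<lambda>c. poly_fract (Const c)) \<union> S"
  have K: "generate_field ?R H = ?K" unfolding adjoin_fractions_def H_def ..
  have carr: "x \<in> carrier ?R" if "x \<in> ?K" for x using that adjoin_fractions_subset by blast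
  have "x + y \<in> ?K" "x * y \<in> ?K" if "x \<in> ?K" "y \<in> ?K" for x y
    using generate_field.eng_add[of x ?R H y] generate_field.eng_mult[of x ?R H y] that
    by (simp_all only: K function_field_ops(3,4))
  moreover have "- x \<in> ?K" if "x \<in> ?K" for x
    using generate_field.a_inv[of x ?R H] that function_field_ops(5)[OF carr[OF that]]
    by (simp only: K)
  moreover have "inverse x \<in> ?K" if "x \<in> ?K" for x
  proof (cases "x = 0")
    case False
    then show ?thesis
      using generate_field.m_inv[of x ?R H] that function_field_ops(6)[OF carr[OF that] False]
      by (simp only: K function_field_ops(2) simp_thms)
  qed (use 0 in simp)
  ultimately show ?thesis using 0 unfolding subfield_set_def by simp
qed

lemma ring_endo_fixes_adjoin_fractions:
  assumes \<sigma>: "ring_endo \<sigma>" "\<And>c. \<sigma> (cst c) = cst c" "\<And>x. x \<in> S \<Longrightarrow> \<sigma> x = x"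
    and x: "x \<in> adjoin_fractions n S"
  shows "\<sigma> x = x"
proof -
  have carr: "x \<in> carrier (function_field n)"
    if "x \<in> generate_field (function_field n) (range (\<lambda>c. poly_fract (Const c)) \<union> S)" for x
    using that adjoin_fractions_subset unfolding adjoin_fractions_def by blast
  show ?thesis
    using x unfolding adjoin_fractions_def
  proof induction
    case (incl h)
    then show ?case using \<sigma> by (auto simp: cst_def)
  qed (auto simp: function_field_ops carr ring_endoD[OF \<sigma>(1)] ring_endo_inverse[OF \<sigma>(1)])
qed

end

text \<open>The identity substitution \<open>subst_poly Var f\<close> spells a polynomial out as a
  sum of constants times products of coordinates, all of which lie in L.\<close>

lemma function_field_subset:
  fixes L :: "'a::field mpoly fract set"
  assumes L: "subfield_set L" "\<And>c. cst c \<in> L" "\<And>i. i \<in> {1..n} \<Longrightarrow> coord i \<in> L"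
  shows "carrier (function_field n) \<subseteq> L"
proof
  have pf: "poly_fract f \<in> L" if f: "f \<in> polys_in n" for f
  proof -
    have "poly_fract f = poly_fract (subst_poly Var f)" by (simp add: subst_poly_id)
    also have "\<dots> = (\<Sum>k \<in> Poly_Mapping.keys f. cst (Poly_Mapping.lookup f k) *
        (\<Prod>i \<in> Poly_Mapping.keys k. coord i ^ Poly_Mapping.lookup k i))"
      by (simp add: subst_poly_def poly_fract_sum poly_fract_simps poly_fract_prod poly_fract_power
          cst_def coord_def)
    also have "\<dots> \<in> L"
    proof (intro subfield_set_sum[OF L(1)] subfield_setD(4,9)[OF L(1)] subfield_set_prod[OF L(1)] L(2,3))
      fix k i assume "k \<in> Poly_Mapping.keys f" "i \<in> Poly_Mapping.keys k"
      then show "i \<in> {1..n}" using f unfolding polys_in_def by blast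
    qed
    finally show ?thesis .
  qed
  fix x :: "'a mpoly fract" assume "x \<in> carrier (function_field n)"
  then show "x \<in> L"
    by (auto simp: in_function_field_iff Fract_eq_divide intro!: subfield_setD(8)[OF L(1)] pf)
qed

section \<open>The Sylow subgroup and its invariants\<close>

text \<open>The parameter \<open>ty\<close> ties the locale to the coefficient field, which the
  types of the numeric parameters do not mention.\<close>

locale sylow_unitary =
  fixes p e q m :: nat and ty :: "'a::{field,finite} itself"
  assumes prime_p: "prime p" and e_pos: "e \<ge> 1" and q_def: "q = p ^ e"
    and card_field: "CARD('a) = q\<^sup>2" and m_pos: "m \<ge> 1"
begin

abbreviation n :: nat where "n \<equiv> 2 * m"

abbreviation G :: "'a mat monoid" where "G \<equiv> sylow_GU q n"

definition \<Gamma> :: "('a mpoly fract \<Rightarrow> 'a mpoly fract) set" where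
  "\<Gamma> = act_fract n ` carrier G"

definition orbit_prod :: "nat \<Rightarrow> 'a mpoly fract" where
  "orbit_prod j = poly_fract (orbit_product G n (Var j))"

definition gens :: "'a mpoly fract set" where
  "gens = orbit_prod ` {1..m+1} \<union> (\<lambda>k. poly_fract (h_poly q m k)) ` {1..m-1}"

abbreviation K :: "'a mpoly fract set" where "K \<equiv> adjoin_fractions n gens"

lemma q_ge_2: "q \<ge> 2"
proof -
  have "p ^ 1 \<le> p ^ e" using e_pos prime_p by (intro power_increasing) (auto dest: prime_gt_0_nat)
  then show ?thesis using prime_ge_2_nat[OF prime_p] q_def by simp
qed

text \<open>The constants embed the coefficient field, so p is 0 among the fractions; the
  characteristic divides the prime p and is not 1.\<close>

lemma char_fract: "prime CHAR('a mpoly fract)" "q = CHAR('a mpoly fract) ^ e"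
proof -
  have "of_nat k = (cst (of_nat k) :: 'a mpoly fract)" for k
    by (induction k) (simp_all add: cst_simps)
  moreover have "of_nat p = (0 :: 'a)"
    using CHAR_finite_field[where 'a = 'a, of p e] of_nat_CHAR[where 'a = 'a] prime_p card_field q_def
    by simp
  ultimately have "of_nat p = (0 :: 'a mpoly fract)" by (simp add: cst_simps)
  then have "CHAR('a mpoly fract) dvd p" by (simp add: of_nat_eq_0_iff_char_dvd)
  then have "CHAR('a mpoly fract) = 1 \<or> CHAR('a mpoly fract) = p"
    using prime_p unfolding prime_nat_iff by blast
  then have "CHAR('a mpoly fract) = p"
    using CHAR_not_1'[where 'a = "'a mpoly fract"] by simp
  then show "prime CHAR('a mpoly fract)" "q = CHAR('a mpoly fract) ^ e"
    using prime_p q_def by simp_all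
qed

lemma power_qq: "(a ^ q) ^ q = a" for a :: 'a
  using power_card_eq_same[of a] card_field by (simp add: power2_eq_square flip: power_mult)

lemma subgroup_G: "subgroup (carrier G) (GL n)"
  using subgroup_sylow_GU[OF prime_p q_def card_field] .

lemma G_in_GL: "g \<in> carrier G \<Longrightarrow> g \<in> carrier (GL n)"
  using subgroup.subset[OF subgroup_G] by blast

lemma inv_in_G: "g \<in> carrier G \<Longrightarrow> inv\<^bsub>GL n\<^esub> g \<in> carrier G"
  using subgroup.m_inv_closed[OF subgroup_G] .

lemma G_entries:
  assumes "A \<in> carrier G"
  shows "A \<in> carrier_mat n n" "i < n \<Longrightarrow> A $$ (i, i) = 1" "i < j \<Longrightarrow> j < n \<Longrightarrow> A $$ (i, j) = 0"
    "j < n \<Longrightarrow> l < n \<Longrightarrow>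
      (\<Sum>r<n. A $$ (r, j) * A $$ (n - 1 - r, l) ^ q) = (if j + l + 1 = n then 1 else 0)"
proof -
  show A: "A \<in> carrier_mat n n" using assms G_in_GL GL_simps(3) by blast
  show "i < n \<Longrightarrow> A $$ (i, i) = 1" "i < j \<Longrightarrow> j < n \<Longrightarrow> A $$ (i, j) = 0"
    using assms by (auto simp: sylow_GU_def lower_unitriangular_def)
  show "j < n \<Longrightarrow> l < n \<Longrightarrow>
      (\<Sum>r<n. A $$ (r, j) * A $$ (n - 1 - r, l) ^ q) = (if j + l + 1 = n then 1 else 0)"
    using assms unitary_iff[OF A, of q] by (simp add: sylow_GU_def)
qed

lemma finite_\<Gamma>: "finite \<Gamma>"
  unfolding \<Gamma>_def
  by (intro finite_imageI finite_subset[OF _ finite_carrier_mat[of n]]) (use G_entries(1) in blast)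

lemma ring_endo_\<Gamma>: "\<sigma> \<in> \<Gamma> \<Longrightarrow> ring_endo \<sigma>"
  using ring_endo_act_fract G_in_GL unfolding \<Gamma>_def by blast

lemma \<Gamma>_cst: "\<sigma> \<in> \<Gamma> \<Longrightarrow> \<sigma> (cst c) = cst c"
  using act_fract_cst G_in_GL unfolding \<Gamma>_def by blast

text \<open>The matrix acting on coordinates is the inverse of the group element. It lies in G
  again, so \<open>G_entries\<close> applies to it directly.\<close>

lemma \<Gamma>_coord:
  assumes "\<sigma> \<in> \<Gamma>"
  obtains A where "A \<in> carrier G"
    "\<And>i. i \<in> {1..n} \<Longrightarrow> \<sigma> (coord i) = (\<Sum>j=1..n. cst (A $$ (i - 1, j - 1)) * coord j)"
  using assms act_fract_coord[OF G_in_GL] inv_in_G unfolding \<Gamma>_def by blast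

text \<open>The group element is the inverse of a root matrix, so that the root matrix itself acts
  on the coordinates. Row i, counted from 0, belongs to coordinate \<open>Suc i\<close>.\<close>

lemma \<Gamma>_root:
  assumes i: "i < n" and supp: "\<And>c. a c \<noteq> 0 \<Longrightarrow> c < i \<and> c + i \<le> n - 1"
    and tr: "a (n - 1 - i) + a (n - 1 - i) ^ q = 0"
  shows "\<exists>\<sigma>\<in>\<Gamma>. (\<forall>j\<in>{1..i}. \<sigma> (coord j) = coord j) \<and>
    \<sigma> (coord (Suc i)) = coord (Suc i) + (\<Sum>j=1..i. cst (a (j - 1)) * coord j)"
proof -
  interpret GL: group "GL n :: 'a mat monoid" by (rule group_GL)
  let ?A = "root_mat q n i a"
  have A: "?A \<in> carrier G"
    by (rule root_mat_in_sylow_GU[OF prime_p q_def card_field q_ge_2 i]) (use supp tr in blast)+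
  define g where "g = inv\<^bsub>GL n\<^esub> ?A"
  have g: "g \<in> carrier G" "inv\<^bsub>GL n\<^esub> g = ?A"
    unfolding g_def using A inv_in_G GL.inv_inv G_in_GL by simp_all
  have act: "act_fract n g (coord j) = (\<Sum>k=1..n. cst (?A $$ (j - 1, k - 1)) * coord k)" if "j \<in> {1..n}" for j
    using act_fract_coord[OF G_in_GL[OF g(1)] that] by (simp only: g(2))
  show ?thesis
  proof (intro bexI[of _ "act_fract n g"] conjI ballI)
    show "act_fract n g \<in> \<Gamma>" unfolding \<Gamma>_def using g(1) by blast
    fix j assume j: "j \<in> {1..i}"
    \<comment> \<open>The rows above row i are those of the identity: the correction in row j - 1
      involves a(n - j), which vanishes because n - j + i > n - 1.\<close>
    have "?A $$ (j - 1, k - 1) = (if k = j then 1 else 0)" if "k \<in> {1..n}" for k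
    proof -
      have "a (n - 1 - (j - 1)) = 0" using supp[of "n - 1 - (j - 1)"] i j by force
      moreover have "a i = 0" using supp[of i] by blast
      ultimately show ?thesis using i j that q_ge_2 by (auto simp: root_mat_def power_0_left)
    qed
    then have "(\<Sum>k=1..n. cst (?A $$ (j - 1, k - 1)) * coord k) = (\<Sum>k=1..n. if k = j then coord k else 0)"
      by (intro sum.cong refl) (simp only: cst_simps mult_1 mult_zero_left split: if_split, simp)
    then have "act_fract n g (coord j) = (\<Sum>k=1..n. if k = j then coord k else 0)"
      using i j by (subst act) auto
    then show "act_fract n g (coord j) = coord j" using i j by simp
  next
    have "?A $$ (i, k - 1) = (if k = Suc i then 1 else 0) + (if k \<in> {1..i} then a (k - 1) else 0)"
      if "k \<in> {1..n}" for k
    proof -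
      have "a (k - 1) = 0" if "k \<notin> {1..i}"
        using supp[of "k - 1"] that \<open>k \<in> {1..n}\<close> by (cases "a (k - 1) = 0") auto
      then show ?thesis using i that by (auto simp: root_mat_def)
    qed
    then have "act_fract n g (coord (Suc i)) = (\<Sum>k=1..n. (if k = Suc i then coord k else 0)
        + (if k \<in> {1..i} then cst (a (k - 1)) * coord k else 0))"
      using i by (subst act) (auto simp: cst_simps intro!: sum.cong)
    also have "\<dots> = coord (Suc i) + (\<Sum>k\<in>{1..n} \<inter> {1..i}. cst (a (k - 1)) * coord k)"
      using i by (simp only: sum.distrib sum.inter_restrict finite_atLeastAtMost) simp
    also have "{1..n} \<inter> {1..i} = {1..i}" using i by auto
    finally show "act_fract n g (coord (Suc i)) = coord (Suc i) + (\<Sum>j=1..i. cst (a (j - 1)) * coord j)" .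
  qed
qed

lemma act_poly_Var:
  assumes "g \<in> carrier G" "i \<in> {1..n}"
  shows "act_poly n g (Var i) = (\<Sum>j=1..n. Const ((inv\<^bsub>GL n\<^esub> g) $$ (i - 1, j - 1)) * Var j)"
  using assms by (simp add: act_poly_def subst_poly_Var lin_subst_def)

section \<open>Invariance of the generators\<close>

lemma gens_subset: "gens \<subseteq> carrier (function_field n)"
proof -
  have "orbit_product G n (Var j) \<in> polys_in n" if "j \<in> {1..m+1}" for j
  proof -
    have "act_poly n g (Var j) \<in> polys_in n" if g: "g \<in> carrier G" for g
    proof -
      have "j \<in> {1..n}" using \<open>j \<in> {1..m+1}\<close> m_pos by auto
      then show ?thesis
        by (subst act_poly_Var[OF g]) (auto intro!: polys_in_sum polys_in_mult polys_in_Const polys_in_Var)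
    qed
    then show ?thesis unfolding orbit_product_def orbit_def by (intro polys_in_prod) blast
  qed
  moreover have "(h_poly q m k :: 'a mpoly) \<in> polys_in n" for k
    unfolding h_poly_def
    by (intro polys_in_sum polys_in_add polys_in_mult polys_in_power polys_in_Var) auto
  ultimately show ?thesis
    unfolding gens_def orbit_prod_def by (auto intro!: poly_fract_in_function_field)
qed

lemmas K_field = subfield_set_adjoin_fractions[OF gens_subset]

lemma finite_orbit: "finite (orbit G (act_poly n) f)"
proof -
  have "finite (carrier G)"
    by (rule finite_subset[OF _ finite_carrier_mat[of n]]) (use G_entries(1) in blast)
  moreover have "orbit G (act_poly n) f = (\<lambda>g. act_poly n g f) ` carrier G"
    unfolding orbit_def by blast
  ultimately show ?thesis by simp
qed

text \<open>A group element permutes the finite orbit and so only reorders the factors; injectivity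
  comes from the trivial kernel of \<open>act_poly n g\<close>.\<close>

lemma \<Gamma>_orbit_prod: "\<sigma> \<in> \<Gamma> \<Longrightarrow> \<sigma> (orbit_prod j) = orbit_prod j"
proof -
  assume "\<sigma> \<in> \<Gamma>"
  then obtain g where g: "g \<in> carrier G" "\<sigma> = act_fract n g" unfolding \<Gamma>_def by blast
  let ?O = "orbit G (act_poly n) (Var j)"
  have inj: "inj_on (act_poly n g) ?O"
  proof (rule inj_onI)
    fix f f' :: "'a mpoly"
    assume eq: "act_poly n g f = act_poly n g f'"
    have "act_poly n g (f - f') = 0"
      using eq subst_poly_add[of _ "f - f'" f'] unfolding act_poly_def by simp
    then show "f = f'" using act_poly_eq_0_iff[OF G_in_GL[OF g(1)]] by fastforce
  qed
  have "act_poly n g ` ?O \<subseteq> ?O"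
  proof clarify
    fix f assume "f \<in> ?O"
    then obtain k where k: "k \<in> carrier G" "f = act_poly n k (Var j)" unfolding orbit_def by blast
    have "act_poly n g f = act_poly n (g * k) (Var j)"
      unfolding k(2) using act_poly_mult[OF G_in_GL[OF g(1)] G_in_GL[OF k(1)]] by simp
    moreover have "g * k \<in> carrier G"
      using subgroup.m_closed[OF subgroup_G g(1) k(1)] by (simp add: GL_simps)
    ultimately show "act_poly n g f \<in> ?O" unfolding orbit_def by blast
  qed
  then have "act_poly n g ` ?O = ?O" by (rule endo_inj_surj[OF finite_orbit _ inj])
  then have "bij_betw (act_poly n g) ?O ?O" using inj by (simp add: bij_betw_def)
  then have "(\<Prod>y\<in>?O. act_poly n g y) = \<Prod>?O" by (rule prod.reindex_bij_betw)
  then have "act_poly n g (\<Prod>?O) = \<Prod>?O" by (simp add: act_poly_def subst_poly_prod)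
  then show ?thesis
    by (simp add: orbit_prod_def orbit_product_def g(2) act_fract_poly_fract G_in_GL[OF g(1)])
qed

lemma h_poly_eq:
  "poly_fract (h_poly q m k :: 'a mpoly) = (\<Sum>i=1..m. coord i * coord (n + 1 - i) ^ (q ^ (2*k - 1))
     + coord i ^ (q ^ (2*k - 1)) * coord (n + 1 - i))"
  unfolding h_poly_def poly_fract_sum poly_fract_simps poly_fract_power coord_def
  by (intro sum.cong refl) (simp add: algebra_simps Suc_diff_le)

text \<open>The indices r \<ge> m supply the second summands of h_k, with i = n - r. The result has
  the shape of the sums in \<open>unitary_iff\<close>.\<close>

lemma h_poly_eq_pairing:
  "poly_fract (h_poly q m k :: 'a mpoly) = (\<Sum>r<n. coord (r + 1) * coord (n - r) ^ (q ^ (2*k - 1)))"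
proof -
  let ?Q = "q ^ (2*k - 1)"
  have "(\<Sum>r<n. coord (r + 1) * coord (n - r) ^ ?Q)
      = (\<Sum>r<m. coord (r + 1) * coord (n - r) ^ ?Q) + (\<Sum>r\<in>{m..<n}. coord (r + 1) * coord (n - r) ^ ?Q :: 'a mpoly fract)"
    by (subst sum.union_disjoint[symmetric]) (auto intro!: sum.cong)
  also have "(\<Sum>r<m. coord (r + 1) * coord (n - r) ^ ?Q) = (\<Sum>i=1..m. coord i * coord (n + 1 - i) ^ ?Q :: 'a mpoly fract)"
    by (rule sum.reindex_bij_witness[of _ "\<lambda>i. i - 1" "\<lambda>r. r + 1"]) auto
  also have "(\<Sum>r\<in>{m..<n}. coord (r + 1) * coord (n - r) ^ ?Q) = (\<Sum>i=1..m. coord i ^ ?Q * coord (n + 1 - i) :: 'a mpoly fract)"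
    by (rule sum.reindex_bij_witness[of _ "\<lambda>i. n - i" "\<lambda>r. n - r"])
      (auto simp: mult.commute Suc_diff_le)
  finally show ?thesis by (simp add: h_poly_eq sum.distrib)
qed

text \<open>On the coefficient field, raising to q^(2k-1) is raising to q. Substituting Ax into the
  pairing of x with its twist therefore produces the entries of A^T J bar(A), which are those of
  J.\<close>

lemma \<Gamma>_h_poly:
  assumes \<sigma>: "\<sigma> \<in> \<Gamma>" and k: "k \<ge> 1"
  shows "\<sigma> (poly_fract (h_poly q m k)) = poly_fract (h_poly q m k)"
proof -
  let ?Q = "q ^ (2*k - 1)"
  obtain A where A: "A \<in> carrier G"
    "\<And>i. i \<in> {1..n} \<Longrightarrow> \<sigma> (coord i) = (\<Sum>j=1..n. cst (A $$ (i - 1, j - 1)) * coord j)"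
    using \<Gamma>_coord[OF \<sigma>] by blast
  note E = ring_endo_\<Gamma>[OF \<sigma>]
  have \<sigma>': "\<sigma> (coord (r + 1)) = (\<Sum>j<n. cst (A $$ (r, j)) * coord (j + 1))" if "r < n" for r
  proof -
    have "\<sigma> (coord (r + 1)) = (\<Sum>j=1..n. cst (A $$ (r, j - 1)) * coord j)"
      using A(2)[of "r + 1"] that by simp
    also have "\<dots> = (\<Sum>j<n. cst (A $$ (r, j)) * coord (j + 1))"
      by (rule sum.reindex_bij_witness[of _ "\<lambda>j. j + 1" "\<lambda>j. j - 1"]) auto
    finally show ?thesis .
  qed
  \<comment> \<open>Here k \<ge> 1 matters: at k = 0 truncated subtraction would turn the exponent
    into q^0.\<close>
  have pow: "(a :: 'a) ^ ?Q = a ^ q" for a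
  proof -
    have "(a ^ q) ^ (q ^ (2 * s)) = a ^ q" for s
    proof (induction s)
      case (Suc s)
      have "(a ^ q) ^ (q ^ (2 * Suc s)) = (((a ^ q) ^ (q ^ (2 * s))) ^ q) ^ q"
        by (simp add: mult_ac flip: power_mult)
      then show ?case using Suc by (simp add: power_qq)
    qed simp
    moreover obtain s where "k = Suc s" using k by (cases k) auto
    ultimately show ?thesis by (simp flip: power_mult)
  qed
  have powr: "\<sigma> (coord (n - r)) ^ ?Q = (\<Sum>l<n. cst (A $$ (n - 1 - r, l) ^ q) * coord (l + 1) ^ ?Q)"
    if "r < n" for r
  proof -
    have "n - r = n - 1 - r + 1" using that by simp
    then have "\<sigma> (coord (n - r)) = (\<Sum>l<n. cst (A $$ (n - 1 - r, l)) * coord (l + 1))"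
      using \<sigma>'[of "n - 1 - r"] that by simp
    then show ?thesis
      by (simp only: frobenius_sum[OF char_fract] power_mult_distrib pow flip: cst_power)
  qed
  have "\<sigma> (poly_fract (h_poly q m k))
      = (\<Sum>r<n. (\<Sum>j<n. cst (A $$ (r, j)) * coord (j + 1)) * (\<Sum>l<n. cst (A $$ (n - 1 - r, l) ^ q) * coord (l + 1) ^ ?Q))"
    unfolding h_poly_eq_pairing ring_endo_sum[OF E] ring_endoD(2,7)[OF E]
    by (intro sum.cong refl) (simp only: \<sigma>' powr lessThan_iff)
  also have "\<dots> = (\<Sum>r<n. \<Sum>j<n. \<Sum>l<n. cst (A $$ (r, j) * A $$ (n - 1 - r, l) ^ q) * (coord (j + 1) * coord (l + 1) ^ ?Q))"
    by (simp only: sum_product cst_simps mult_ac)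
  \<comment> \<open>The sum over rows moves inside, where its coefficient is the left side of the
    unitary relation for columns j and l.\<close>
  also have "\<dots> = (\<Sum>j<n. \<Sum>l<n. \<Sum>r<n. cst (A $$ (r, j) * A $$ (n - 1 - r, l) ^ q) * (coord (j + 1) * coord (l + 1) ^ ?Q))"
    by (subst sum.swap, rule sum.cong[OF refl], rule sum.swap)
  also have "\<dots> = (\<Sum>j<n. \<Sum>l<n. if l = n - 1 - j then coord (j + 1) * coord (l + 1) ^ ?Q else 0)"
  proof (intro sum.cong[OF refl])
    fix j l assume "j \<in> {..<n}" "l \<in> {..<n}"
    then have "(\<Sum>r<n. A $$ (r, j) * A $$ (n - 1 - r, l) ^ q) = (if l = n - 1 - j then 1 else 0)"
      using G_entries(4)[OF A(1), of j l] by auto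
    then show "(\<Sum>r<n. cst (A $$ (r, j) * A $$ (n - 1 - r, l) ^ q) * (coord (j + 1) * coord (l + 1) ^ ?Q))
        = (if l = n - 1 - j then coord (j + 1) * coord (l + 1) ^ ?Q else 0)"
      by (simp only: cst_simps(1,2) mult_1 mult_zero_left flip: sum_distrib_right cst_sum split: if_split) simp
  qed
  also have "\<dots> = (\<Sum>j<n. coord (j + 1) * coord (n - j) ^ ?Q)"
    by (intro sum.cong refl) (auto simp: Suc_diff_Suc)
  finally show ?thesis by (simp only: h_poly_eq_pairing)
qed

lemma \<Gamma>_K:
  assumes \<sigma>: "\<sigma> \<in> \<Gamma>" and x: "x \<in> K"
  shows "\<sigma> x = x"
  by (rule ring_endo_fixes_adjoin_fractions[OF gens_subset ring_endo_\<Gamma>[OF \<sigma>] \<Gamma>_cst[OF \<sigma>] _ x])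
    (use \<Gamma>_orbit_prod[OF \<sigma>] \<Gamma>_h_poly[OF \<sigma>] in \<open>auto simp: gens_def\<close>)

text \<open>A converse to \<open>\<Gamma>_root\<close>: in the first m + 1 coordinates every
  conjugate has the form that a root element produces. The trace condition is trivial for i < m,
  where a(n-1-i) = 0, and comes from unitarity for i = m.\<close>

lemma orbit_Var:
  assumes i: "i \<le> m" and y: "y \<in> orbit G (act_poly n) (Var (Suc i))"
  shows "\<exists>a. (\<forall>c. a c \<noteq> 0 \<longrightarrow> c < i \<and> c + i \<le> n - 1) \<and>
    a (n - 1 - i) + a (n - 1 - i) ^ q = 0 \<and>
    poly_fract y = coord (Suc i) + (\<Sum>j=1..i. cst (a (j - 1)) * coord j)"
proof -
  obtain g where g: "g \<in> carrier G" "y = act_poly n g (Var (Suc i))"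
    using y unfolding orbit_def by blast
  define A where "A = inv\<^bsub>GL n\<^esub> g"
  have A: "A \<in> carrier G" unfolding A_def by (rule inv_in_G[OF g(1)])
  note ent = G_entries[OF A]
  have i': "i < n" using i m_pos by simp
  define a where "a c = (if c < i then A $$ (i, c) else 0)" for c
  have y_eq: "poly_fract y = (\<Sum>k=1..n. cst (A $$ (i, k - 1)) * coord k)"
    using act_poly_Var[OF g(1), of "Suc i"] i'
    by (simp add: g(2) A_def poly_fract_sum poly_fract_simps cst_def coord_def)
  show ?thesis
  proof (intro exI[of _ a] conjI allI impI)
    show "c < i" "c + i \<le> n - 1" if "a c \<noteq> 0" for c
      using that i by (auto simp: a_def split: if_splits)
    show "a (n - 1 - i) + a (n - 1 - i) ^ q = 0"
    proof (cases "i = m")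
      case False
      then show ?thesis using i q_ge_2 by (simp add: a_def power_0_left)
    next
      case True
      \<comment> \<open>Column m - 1 paired with itself. Unless r is m - 1 or m, one of r and n-1-r
        lies above row m - 1, where triangularity makes the entry zero.\<close>
      have "0 = (\<Sum>r<n. A $$ (r, m - 1) * A $$ (n - 1 - r, m - 1) ^ q)"
        using ent(4)[of "m - 1" "m - 1"] m_pos by simp
      also have "\<dots> = (\<Sum>r\<in>{m - 1, m}. A $$ (r, m - 1) * A $$ (n - 1 - r, m - 1) ^ q)"
      proof (rule sum.mono_neutral_right)
        show "\<forall>r\<in>{..<n} - {m - 1, m}. A $$ (r, m - 1) * A $$ (n - 1 - r, m - 1) ^ q = 0"
        proof
          fix r assume "r \<in> {..<n} - {m - 1, m}"
          then have "r < m - 1 \<or> n - 1 - r < m - 1" by auto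
          moreover have "m - 1 < n" using m_pos by simp
          ultimately show "A $$ (r, m - 1) * A $$ (n - 1 - r, m - 1) ^ q = 0"
            using ent(3)[of r "m - 1"] ent(3)[of "n - 1 - r" "m - 1"] q_ge_2
            by (auto simp: power_0_left)
        qed
      qed (use m_pos in auto)
      also have "\<dots> = A $$ (m, m - 1) ^ q + A $$ (m, m - 1)"
      proof -
        have "n - 1 - (m - 1) = m" "n - 1 - m = m - 1" "m - 1 \<noteq> m" using m_pos by auto
        then show ?thesis using ent(2)[of "m - 1"] m_pos by simp
      qed
      finally show ?thesis using True m_pos by (simp add: a_def add.commute mult_2)
    qed
    have "(\<Sum>k=1..n. cst (A $$ (i, k - 1)) * coord k) = (\<Sum>k=1..n. (if k = Suc i then coord k else 0)
        + (if k \<in> {1..i} then cst (a (k - 1)) * coord k else 0))"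
    proof (intro sum.cong refl)
      fix k assume k: "k \<in> {1..n}"
      show "cst (A $$ (i, k - 1)) * coord k = (if k = Suc i then coord k else 0)
        + (if k \<in> {1..i} then cst (a (k - 1)) * coord k else 0)"
        using ent(2)[of i] ent(3)[of i "k - 1"] i' k
        by (cases "k - 1" i rule: linorder_cases) (auto simp: a_def cst_simps)
    qed
    also have "\<dots> = coord (Suc i) + (\<Sum>k\<in>{1..n} \<inter> {1..i}. cst (a (k - 1)) * coord k)"
      using i' by (simp only: sum.distrib sum.inter_restrict finite_atLeastAtMost) simp
    also have "{1..n} \<inter> {1..i} = {1..i}" using i' by auto
    finally show "poly_fract y = coord (Suc i) + (\<Sum>j=1..i. cst (a (j - 1)) * coord j)"
      using y_eq by simp
  qed
qed

lemma linear_form_in_tower: "(\<Sum>j=1..i. cst (c j) * coord j) \<in> tower K coord i"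
proof (intro subfield_set_sum subfield_setD(4) subfield_set_tower K_field)
  show "cst (c j) \<in> tower K coord i" for j
    by (rule subsetD[OF tower_mono[OF K_field, of 0]]) (simp_all add: adjoin_fractions_incl)
  show "coord j \<in> tower K coord i" if "j \<in> {1..i}" for j
    using in_tower[OF K_field that] .
qed

lemma step_orbit:
  assumes i: "i \<le> m"
  shows "\<exists>P \<in> polys_over (tower K coord i). P \<noteq> 0 \<and> poly P (coord (Suc i)) = 0 \<and>
    Polynomial.degree P \<le> card ((\<lambda>\<sigma>. \<sigma> (coord (Suc i))) ` {\<sigma> \<in> \<Gamma>. \<forall>j\<in>{1..i}. \<sigma> (coord j) = coord j})"
proof -
  let ?L = "tower K coord i" and ?O = "orbit G (act_poly n) (Var (Suc i) :: 'a mpoly)"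
  note L = subfield_set_tower[OF K_field, of coord i]
  \<comment> \<open>At t = x_{i+1} the factors t + (y - x_{i+1}) become the orbit elements, so the
    product takes the value N(x_{i+1}). Its coefficients lie in the tower since each y - x_{i+1} is
    a linear form in x_1, ..., x_i.\<close>
  define Q where "Q = (\<Prod>y\<in>?O. [:poly_fract y - coord (Suc i), 1:])"
  define P where "P = Q - [:orbit_prod (Suc i):]"
  have "?O \<noteq> {}" using subgroup.one_closed[OF subgroup_G] by (auto simp: orbit_def)
  then have card_pos: "card ?O > 0" using finite_orbit by (simp add: card_gt_0_iff)
  have dQ: "Polynomial.degree Q = card ?O" unfolding Q_def by (subst degree_prod_sum_eq) auto
  have P0: "P \<noteq> 0"
  proof
    assume "P = 0"
    then have "Q = [:orbit_prod (Suc i):]" by (simp add: P_def)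
    then show False using dQ card_pos by simp
  qed
  have root: "poly P (coord (Suc i)) = 0"
    by (simp add: P_def Q_def poly_prod orbit_prod_def orbit_product_def poly_fract_prod)
  have PL: "P \<in> polys_over ?L"
  proof -
    have "orbit_prod (Suc i) \<in> K" using i by (intro adjoin_fractions_incl(2)) (auto simp: gens_def)
    then have "orbit_prod (Suc i) \<in> ?L" using subsetD[OF tower_mono[OF K_field, of 0 i coord]] by simp
    moreover have "poly_fract y - coord (Suc i) \<in> ?L" if y: "y \<in> ?O" for y
    proof -
      obtain a where "poly_fract y = coord (Suc i) + (\<Sum>j=1..i. cst (a (j - 1)) * coord j)"
        using orbit_Var[OF i y] by blast
      then show ?thesis by (simp only: add_diff_cancel_left' linear_form_in_tower)
    qed
    ultimately show ?thesis unfolding P_def Q_def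
      by (intro polys_over_closed(3,5,7)[OF L] polys_over_prod[OF L])
  qed
  have "Polynomial.degree P \<le> card ?O"
    unfolding P_def using dQ by (intro degree_diff_le) auto
  also have "\<dots> \<le> card ((\<lambda>\<sigma>. \<sigma> (coord (Suc i))) ` {\<sigma> \<in> \<Gamma>. \<forall>j\<in>{1..i}. \<sigma> (coord j) = coord j})"
  proof -
    have "inj_on poly_fract ?O" by (rule inj_onI) (simp add: poly_fract_simps)
    then have "card ?O = card (poly_fract ` ?O)" by (rule card_image[symmetric])
    also have "\<dots> \<le> card ((\<lambda>\<sigma>. \<sigma> (coord (Suc i))) ` {\<sigma> \<in> \<Gamma>. \<forall>j\<in>{1..i}. \<sigma> (coord j) = coord j})"
    proof (intro card_mono finite_imageI)
      \<comment> \<open>Every orbit element is already reached by a root element, which fixes x_1,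
        ..., x_i.\<close>
      show "poly_fract ` ?O \<subseteq> (\<lambda>\<sigma>. \<sigma> (coord (Suc i))) ` {\<sigma> \<in> \<Gamma>. \<forall>j\<in>{1..i}. \<sigma> (coord j) = coord j}"
      proof
        fix z assume "z \<in> poly_fract ` ?O"
        then obtain y where y: "y \<in> ?O" "z = poly_fract y" by blast
        obtain a where a: "\<forall>c. a c \<noteq> 0 \<longrightarrow> c < i \<and> c + i \<le> n - 1"
          "a (n - 1 - i) + a (n - 1 - i) ^ q = 0"
          "poly_fract y = coord (Suc i) + (\<Sum>j=1..i. cst (a (j - 1)) * coord j)"
          using orbit_Var[OF i y(1)] by blast
        have "i < n" using i m_pos by simp
        from \<Gamma>_root[where a = a, OF this _ a(2)] a(1) obtain \<sigma> where
          "\<sigma> \<in> \<Gamma>" "\<forall>j\<in>{1..i}. \<sigma> (coord j) = coord j"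
          "\<sigma> (coord (Suc i)) = coord (Suc i) + (\<Sum>j=1..i. cst (a (j - 1)) * coord j)" by blast
        then show "z \<in> (\<lambda>\<sigma>. \<sigma> (coord (Suc i))) ` {\<sigma> \<in> \<Gamma>. \<forall>j\<in>{1..i}. \<sigma> (coord j) = coord j}"
          unfolding y(2) a(3) by (intro image_eqI[of _ _ \<sigma>]) simp_all
      qed
    qed (use finite_\<Gamma> in simp)
    finally show ?thesis .
  qed
  finally show ?thesis using P0 root PL by blast
qed

lemma step_h:
  assumes i: "m < i" "i < n"
  shows "\<exists>P \<in> polys_over (tower K coord i). P \<noteq> 0 \<and> poly P (coord (Suc i)) = 0 \<and>
    Polynomial.degree P \<le> card ((\<lambda>\<sigma>. \<sigma> (coord (Suc i))) ` {\<sigma> \<in> \<Gamma>. \<forall>j\<in>{1..i}. \<sigma> (coord j) = coord j})"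
proof -
  let ?L = "tower K coord i"
  note L = subfield_set_tower[OF K_field, of coord i]
  \<comment> \<open>Coordinate \<open>Suc i\<close> is n + 1 - r, the partner of x_r in each h_k,
    and r < m keeps h_1, ..., h_r among the generators.\<close>
  define r where "r = n - i"
  have r: "r \<ge> 1" "r < m" "n + 1 - r = Suc i" "n - 1 - i = r - 1" "r < i" "r + i = n"
    using i by (auto simp: r_def)
  have coord_L: "coord j \<in> ?L" if "j \<in> {1..i}" for j using in_tower[OF K_field that] .
  have char2: "q\<^sup>2 = CHAR('a mpoly fract) ^ (e * 2)" using char_fract(2) by (simp add: power_mult)
  \<comment> \<open>Constants are fixed by the q^2-power map, so the Moore matrix is formed with Q =
    q^2; this yields the exponents q^(2a) of \<open>unitary_elimination\<close>.\<close>
  have "cst c ^ q\<^sup>2 = cst c" for c :: 'a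
    using power_card_eq_same[of c] card_field by (simp flip: cst_power)
  then obtain l where l: "\<And>a. l a \<in> ?L"
    "\<forall>i\<in>{1..r}. (\<Sum>a<r. l a * coord i ^ ((q\<^sup>2) ^ a)) = (if i = r then 1 else 0)"
    using dual_moore_row[where x = coord and r = r, OF char_fract(1) char2 L _ r(1) card_field[symmetric] _ linear_form_inject]
      coord_L r(5) by auto
  have "\<exists>P \<in> polys_over ?L. P \<noteq> 0 \<and> poly P (coord (n + 1 - r)) = 0 \<and> Polynomial.degree P \<le> q ^ (2*r - 1)"
  proof (rule unitary_elimination[where l = l and y = "\<lambda>i. coord (n + 1 - i)", OF char_fract q_ge_2 L r(1) l(1)])
    show "(\<Sum>a<r. l a * coord i ^ (q ^ (2 * a))) = (if i = r then 1 else 0)" if "i \<in> {1..r}" for i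
      using l(2) that by (simp only: power_mult)
    fix k assume k: "k \<in> {1..r}"
    let ?t = "\<lambda>i. coord i * coord (n + 1 - i) ^ (q ^ (2*k - 1)) + coord i ^ (q ^ (2*k - 1)) * coord (n + 1 - i) :: 'a mpoly fract"
    have "poly_fract (h_poly q m k) \<in> K" using k r(2) by (intro adjoin_fractions_incl(2)) (auto simp: gens_def)
    then have "(\<Sum>i=1..m. ?t i) \<in> ?L"
      using subsetD[OF tower_mono[OF K_field, of 0 i coord]] by (simp add: h_poly_eq)
    \<comment> \<open>The summands beyond r involve only coordinates up to n - r, all in the tower;
      subtracting them truncates h_k to its first r pairs.\<close>
    moreover have "(\<Sum>i=r+1..m. ?t i) \<in> ?L"
      using i r by (intro subfield_set_sum[OF L] subfield_setD(3,4,9)[OF L] coord_L) auto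
    ultimately have "(\<Sum>i=1..m. ?t i) - (\<Sum>i=r+1..m. ?t i) \<in> ?L" by (rule subfield_setD(7)[OF L])
    moreover have "(\<Sum>i=1..m. ?t i) = (\<Sum>i=1..r. ?t i) + (\<Sum>i=r+1..m. ?t i)"
      using sum.ub_add_nat[of 1 r ?t "m - r"] r by simp
    ultimately show "(\<Sum>i=1..r. ?t i) \<in> ?L" by (simp only: add_diff_cancel_right')
  qed
  then obtain P where P: "P \<in> polys_over ?L" "P \<noteq> 0" "poly P (coord (Suc i)) = 0"
    "Polynomial.degree P \<le> q ^ (2*r - 1)" using r(3) by auto
  have "q ^ (2*r - 1) \<le> card ((\<lambda>\<sigma>. \<sigma> (coord (Suc i))) ` {\<sigma> \<in> \<Gamma>. \<forall>j\<in>{1..i}. \<sigma> (coord j) = coord j})"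
  proof -
    let ?Z = "{a :: 'a. a + a ^ q = 0}"
    \<comment> \<open>The coefficients of x_1, ..., x_{r-1} are free, while that of x_r has trace
      zero, because n - 1 - i = r - 1 is its column. This gives at least (q^2)^(r-1) * q
      choices.\<close>
    let ?T = "PiE {1..r} (\<lambda>j. if j = r then ?Z else UNIV)"
    let ?f = "\<lambda>c. coord (Suc i) + (\<Sum>j=1..r. cst (c j) * coord j) :: 'a mpoly fract"
    have "q ^ (2*r - 1) = (q\<^sup>2) ^ (r - 1) * q"
    proof -
      have "2 * r - 1 = 2 * (r - 1) + 1" using r(1) by simp
      then show ?thesis by (simp only: power_add power_mult power_one_right)
    qed
    also have "\<dots> \<le> (q\<^sup>2) ^ (r - 1) * card ?Z"
      by (intro mult_left_mono card_trace_zero[OF prime_p q_def card_field q_ge_2]) simp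
    also have "\<dots> = card ?T"
    proof -
      have "{1..r} = insert r {1..<r}" using r(1) by auto
      then have "card ?T = card ?Z * (\<Prod>j\<in>{1..<r}. card (if j = r then ?Z else UNIV))"
        by (simp add: card_PiE)
      also have "(\<Prod>j\<in>{1..<r}. card (if j = r then ?Z else UNIV)) = (\<Prod>j\<in>{1..<r}. q\<^sup>2)"
        by (intro prod.cong refl) (simp add: card_field)
      finally show ?thesis by simp
    qed
    also have "\<dots> = card (?f ` ?T)"
    proof (rule card_image[symmetric])
      have "?T \<subseteq> PiE {1..r} (\<lambda>_. UNIV)" by (rule PiE_mono) simp
      then have "inj_on (\<lambda>c. \<Sum>j=1..r. cst (c j) * coord j) ?T"
        by (rule inj_on_subset[OF linear_form_inject])
      then show "inj_on ?f ?T" by (simp add: inj_on_def)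
    qed
    also have "\<dots> \<le> card ((\<lambda>\<sigma>. \<sigma> (coord (Suc i))) ` {\<sigma> \<in> \<Gamma>. \<forall>j\<in>{1..i}. \<sigma> (coord j) = coord j})"
    proof (intro card_mono finite_imageI)
      show "?f ` ?T \<subseteq> (\<lambda>\<sigma>. \<sigma> (coord (Suc i))) ` {\<sigma> \<in> \<Gamma>. \<forall>j\<in>{1..i}. \<sigma> (coord j) = coord j}"
      proof
        fix z assume "z \<in> ?f ` ?T"
        then obtain c where c: "c \<in> ?T" "z = ?f c" by blast
        define a where "a j = (if j < r then c (Suc j) else 0)" for j
        have supp: "j < i \<and> j + i \<le> n - 1" if "a j \<noteq> 0" for j
          using that r by (auto simp: a_def split: if_splits)
        have "c r \<in> ?Z" using PiE_mem[OF c(1), of r] r(1) by simp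
        then have tr: "a (n - 1 - i) + a (n - 1 - i) ^ q = 0"
          unfolding r(4) using r(1) by (simp add: a_def)
        have "(\<Sum>j=1..i. cst (a (j - 1)) * coord j) = (\<Sum>j=1..r. cst (c j) * coord j)"
          using r(5) by (intro sum.mono_neutral_cong_right) (auto simp: a_def cst_simps)
        moreover obtain \<sigma> where "\<sigma> \<in> \<Gamma>" "\<forall>j\<in>{1..i}. \<sigma> (coord j) = coord j"
          "\<sigma> (coord (Suc i)) = coord (Suc i) + (\<Sum>j=1..i. cst (a (j - 1)) * coord j)"
          using \<Gamma>_root[where a = a, OF i(2) supp tr] by blast
        ultimately show "z \<in> (\<lambda>\<sigma>. \<sigma> (coord (Suc i))) ` {\<sigma> \<in> \<Gamma>. \<forall>j\<in>{1..i}. \<sigma> (coord j) = coord j}"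
          unfolding c(2) by (intro image_eqI[of _ _ \<sigma>]) simp_all
      qed
    qed (use finite_\<Gamma> in simp)
    finally show ?thesis .
  qed
  from le_trans[OF P(4) this] P(1-3) show ?thesis by blast
qed

lemma invariant_field_eq: "invariant_field G n = K"
proof
  show "K \<subseteq> invariant_field G n"
    using adjoin_fractions_subset[OF gens_subset] \<Gamma>_K
    unfolding invariant_field_def \<Gamma>_def by blast
  show "invariant_field G n \<subseteq> K"
  proof
    fix f assume f: "f \<in> invariant_field G n"
    have "carrier (function_field n) \<subseteq> tower K coord n"
    proof (rule function_field_subset[OF subfield_set_tower[OF K_field]])
      show "cst c \<in> tower K coord n" for c
        by (rule subsetD[OF tower_mono[OF K_field, of 0]]) (simp_all add: adjoin_fractions_incl)
    qed (rule in_tower[OF K_field])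
    then have tower: "f \<in> tower K coord n" using f unfolding invariant_field_def by blast
    show "f \<in> K"
    proof (rule invariant_in_base[where \<Gamma> = \<Gamma> and x = coord, OF K_field ring_endo_\<Gamma>])
      show "\<sigma> f = f" if "\<sigma> \<in> \<Gamma>" for \<sigma>
        using that f unfolding invariant_field_def \<Gamma>_def by blast
      \<comment> \<open>Coordinates up to m + 1 are removed by the orbit products, the later ones by
        the h_k.\<close>
      show "\<exists>P \<in> polys_over (tower K coord i). P \<noteq> 0 \<and> poly P (coord (Suc i)) = 0 \<and>
        Polynomial.degree P \<le> card ((\<lambda>\<sigma>. \<sigma> (coord (Suc i))) ` {\<sigma> \<in> \<Gamma>. \<forall>j\<in>{1..i}. \<sigma> (coord j) = coord j})"
        if "i < n" for i
        using step_orbit[of i] step_h[of i] that by (cases "i \<le> m") auto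
    qed (use \<Gamma>_K tower in auto)
  qed
qed

end

theorem theorem4p10:
  fixes p e q m :: nat
  assumes "prime p" and "e \<ge> 1" and "q = p ^ e"
    and "CARD('a::{field,finite}) = q\<^sup>2"
    and "m \<ge> 1"
  shows "invariant_field (sylow_GU q (2*m) :: 'a mat monoid) (2*m) =
    adjoin_fractions (2*m)
      ((\<lambda>j. poly_fract (orbit_product (sylow_GU q (2*m)) (2*m) (Var j))) ` {1..m+1}
       \<union> (\<lambda>k. poly_fract (h_poly q m k)) ` {1..m-1})"
proof -
  interpret sylow_unitary p e q m "TYPE('a)"
    using assms by unfold_locales
  show ?thesis
    using invariant_field_eq unfolding gens_def orbit_prod_def[abs_def] .
qed

end
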